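(* Let $S$ and $\hat S$ be the transfer functions of the leader-follower network and of its reduced order network obtained by clustering according to a partition $\pi$ (all notation as in the context). Assume that $A$ and $B$ are symmetric matrices, that the original network is synchronized, and that $\pi=\{C_1,\dots,C_k\}$ is an almost equitable partition of the connected, weighted, undirected graph $\mathcal{G}$. For $i=1,\dots,m$ let $C_{k_i}$ be the cell of $\pi$ containing the leader $v_i$. Define $$S_{\max,\mathcal{H}_\infty}:=\max_{\lambda\in\sigma(L)\setminus\sigma(\hat L)}\|S_\lambda\|_{\mathcal{H}_\infty},\qquad S_{\min,\mathcal{H}_\infty}:=\min_{\lambda\in\sigma(L)\setminus\{0\}}\sigma_{\min}(S_\lambda(0)).$$ Then $$\|S-\hat S\|_{\mathcal{H}_\infty}^2\le\begin{cases}\displaystyle S_{\max,\mathcal{H}_\infty}^2\max_{1\le i\le m}\left(1-\frac1{|C_{k_i}|}\right)&\text{if the leaders are in (pairwise) different cells},\\[2mm]S_{\max,\mathcal{H}_\infty}^2&\text{otherwise,}\end{cases}$$ and, whenever the denominators are nonzero, $$\frac{\|S-\hat S\|_{\mathcal{H}_\infty}^2}{\|S\|_{\mathcal{H}_\infty}^2}\le\begin{cases}\displaystyle\frac{S_{\max,\mathcal{H}_\infty}^2}{S_{\min,\mathcal{H}_\infty}^2}\max_{1\le i\le m}\left(1-\frac1{|C_{k_i}|}\right)&\text{if the leaders are in (pairwise) different cells},\\[3mm]\displaystyle\frac{S_{\max,\mathcal{H}_\infty}^2}{S_{\min,\mathcal{H}_\infty}^2}&\text{otherwise.}\end{cases}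$$
   Context: Graph. $\mathcal{G}$ is a connected weighted undirected graph on $\mathcal{V}=\{1,\dots,N\}$ with symmetric adjacency matrix $(a_{ij})$, $a_{ij}\ge 0$, $a_{ii}=0$. Its Laplacian is $L\in\mathbb{R}^{N\times N}$ with $L_{ii}=\sum_{j}a_{ij}$ and $L_{ij}=-a_{ij}$ for $i\ne j$. The leaders are distinct nodes $v_1,\dots,v_m\in\mathcal{V}$; $M\in\mathbb{R}^{N\times m}$ has $M_{ij}=1$ if $i=v_j$ and $M_{ij}=0$ otherwise. Network. Let $A,B\in\mathbb{R}^{n\times n}$, $E\in\mathbb{R}^{n\times r}$. The network is $$\dot x=(I_N\otimes A-L\otimes B)x+(M\otimes E)u,\qquad y=(L\otimes I_n)x,$$ with $x=\mathrm{col}(x_1,\dots,x_N)$, $x_i\in\mathbb{R}^n$, and $u\in\mathbb{R}^{mr}$. Its transfer function is $S$. It is synchronized if for $u=0$ and every initial state, $x_i(t)-x_j(t)\to0$ as $t\to\infty$ for all $i,j$ (equivalently, $A-\lambda B$ is Hurwitz for every nonzero eigenvalue $\lambda$ of $L$). Partitions. A partition $\pi=\{C_1,\dots,C_k\}$ of $\mathcal{G}$ is a partition of $\mathcal{V}$ into nonempty pairwise disjoint cells. Its characteristic matrix $P\in\mathbb{R}^{N\times k}$ has $P_{ij}=1$ if $i\in C_j$ and $0$ otherwise. $\pi$ is almost equitable if for all $p\neq q$ the number $d_{pq}(j)=\sum_{i\in C_p}a_{ij}$ is the same for all $j\in C_q$. Reduced network. With $\hat L=(P^TP)^{-1}P^TLP$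 and $\hat M=(P^TP)^{-1}P^TM$, the reduced network is $$\dot{\hat x}=(I_k\otimes A-\hat L\otimes B)\hat x+(\hat M\otimes E)u,\qquad \hat y=(LP\otimes I_n)\hat x,$$ with transfer function $\hat S$. Auxiliary systems. For a nonzero eigenvalue $\lambda$ of $L$, $S_\lambda(s)=\lambda(sI-A+\lambda B)^{-1}E$, the transfer function of $\dot x=(A-\lambda B)x+Ed$, $z=\lambda x$. Spectra. For an almost equitable partition, $\sigma(\hat L)\subseteq\sigma(L)$. The difference $\sigma(L)\setminus\sigma(\hat L)$ is counted with multiplicities: if the eigenvalues of $L$ are listed with multiplicity as $0,\lambda_2,\dots,\lambda_N$ so that $0,\lambda_2,\dots,\lambda_k$ are the eigenvalues of $\hat L$ with multiplicity, then $\sigma(L)\setminus\sigma(\hat L)=\{\lambda_{k+1},\dots,\lambda_N\}$. A maximum over the empty set (case $k=N$) is taken to be $0$. Norms. $\sigma_1(Z)=\lambda_{\max}(Z^TZ)^{1/2}$ is the largest singular value of a real matrix $Z$, and $\sigma_{\min}(Z)=\lambda_{\min}(Z^TZ)^{1/2}$. For complex matrices singular values are the usual ones. For a transfer function $G$ with all poles (as a rational matrix) in the open left half plane, $\|G\|_{\mathcal{H}_\infty}=\sup_{\omega\in\mathbb{R}}\sigma_1(G(i\omega))$.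
   Formalization: The relative bound (second display) is stated only for at least two leaders (m ≥ 2); for a single leader it is false as printed, e.g. N=2, one edge of weight 1, A=0, B=E=1, one cell gives 1 ≤ 1/2. The absolute bound is stated for every m. *)

theory Defs
  imports
    "HOL-Analysis.Analysis"
    "HOL-Computational_Algebra.Polynomial_Factorial"
begin

section \<open>Matrices\<close>

definition kron :: "'a::times^'b^'c \<Rightarrow> 'a^'d^'e \<Rightarrow> 'a^('b \<times> 'd)^('c \<times> 'e)"  (infixr \<open>\<otimes>\<^sub>K\<close> 75)
  where "X \<otimes>\<^sub>K Y = (\<chi> i j. X $ fst i $ fst j * Y $ snd i $ snd j)"

definition charpoly :: "'a::comm_ring_1^'n^'n \<Rightarrow> 'a poly"
  where "charpoly X = det (\<chi> i j. [: - X $ i $ j, if i = j then 1 else 0 :])"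

text \<open>
  Eigenvalues in the ground field, counted with algebraic multiplicity.  Over the reals this lists
  only the real eigenvalues; it is applied there to graph Laplacians (which are symmetric) and to
  their quotients (which are similar to symmetric matrices), whose eigenvalues are all real.
\<close>
definition eigvals :: "'a::field^'n^'n \<Rightarrow> 'a multiset"
  where "eigvals X = proots (charpoly X)"

definition adjoint_matrix :: "complex^'n^'m \<Rightarrow> complex^'m^'n"
  where "adjoint_matrix Z = map_matrix cnj (transpose Z)"

text \<open>
  The eigenvalues of \<open>Z\<^sup>* Z\<close> are real, so \<open>Re\<close> only changes their type.
  Note that \<open>Z\<^sup>* Z\<close> has as many rows as \<open>Z\<close> has columns; thus \<open>sigma_min Z = 0\<close> if \<open>Z\<close> has
  more columns than rows.
\<close>
definition sigma_max :: "complex^'n^'m \<Rightarrow> real"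
  where "sigma_max Z = sqrt (Max (Re ` set_mset (eigvals (adjoint_matrix Z ** Z))))"

definition sigma_min :: "complex^'n^'m \<Rightarrow> real"
  where "sigma_min Z = sqrt (Min (Re ` set_mset (eigvals (adjoint_matrix Z ** Z))))"

section \<open>Rational transfer matrices\<close>

text \<open>
  Transfer functions are matrices over the field of rational functions, so that removable
  singularities are absent: an eigenvalue of the state matrix need not be a pole, and the value there
  is that of the cancelled fraction.  This matters at \<open>0\<close>, e.g. for single integrators.
\<close>
type_synonym ratfun = "complex poly fract"

definition ratfun_pole :: "ratfun \<Rightarrow> complex \<Rightarrow> bool"
  where "ratfun_pole f s \<longleftrightarrow> \<not> (\<exists>p q. poly q s \<noteq> 0 \<and> f = Fract p q)"

text \<open>Unspecified at poles.\<close>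
definition ratfun_eval :: "ratfun \<Rightarrow> complex \<Rightarrow> complex"
  where "ratfun_eval f s = (THE z. \<exists>p q. poly q s \<noteq> 0 \<and> f = Fract p q \<and> z = poly p s / poly q s)"

definition tf_pole :: "ratfun^'u^'y \<Rightarrow> complex \<Rightarrow> bool"
  where "tf_pole G s \<longleftrightarrow> (\<exists>i j. ratfun_pole (G $ i $ j) s)"

definition tf_eval :: "ratfun^'u^'y \<Rightarrow> complex \<Rightarrow> complex^'u^'y"
  where "tf_eval G s = map_matrix (\<lambda>f. ratfun_eval f s) G"

definition ratfun_const :: "real \<Rightarrow> ratfun"
  where "ratfun_const c = Fract [: complex_of_real c :] 1"

text \<open>The transfer function \<open>H (s I - F)\<^sup>-\<^sup>1 G\<close> of \<open>x' = F x + G u\<close>, \<open>y = H x\<close>.\<close>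
definition transfer_function ::
    "real^'x^'x \<Rightarrow> real^'u^'x \<Rightarrow> real^'x^'y \<Rightarrow> ratfun^'u^'y"
  where "transfer_function F G H =
    map_matrix ratfun_const H **
    matrix_inv (mat (Fract [:0, 1:] 1) - map_matrix ratfun_const F) **
    map_matrix ratfun_const G"

text \<open>
  The norm is infinite unless all poles lie in the open left half plane.
\<close>
definition hinf_norm :: "ratfun^'u^'y \<Rightarrow> ennreal"
  where "hinf_norm G =
    (if \<forall>s. tf_pole G s \<longrightarrow> Re s < 0
     then (SUP \<omega>::real. ennreal (sigma_max (tf_eval G (\<i> * complex_of_real \<omega>))))
     else \<infinity>)"

section \<open>Graphs and partitions\<close>

definition weighted_graph :: "real^'N^'N \<Rightarrow> bool"
  where "weighted_graph a \<longleftrightarrow>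
    (\<forall>i j. a $ i $ j = a $ j $ i) \<and> (\<forall>i j. 0 \<le> a $ i $ j) \<and> (\<forall>i. a $ i $ i = 0)"

definition connected_graph :: "real^'N^'N \<Rightarrow> bool"
  where "connected_graph a \<longleftrightarrow> (\<forall>i j. (i, j) \<in> {(p, q). 0 < a $ p $ q}\<^sup>*)"

definition laplacian :: "real^'N^'N \<Rightarrow> real^'N^'N"
  where "laplacian a = (\<chi> i j. if i = j then (\<Sum>l\<in>UNIV. a $ i $ l) else - a $ i $ j)"

definition leader_matrix :: "('m::finite \<Rightarrow> 'N::finite) \<Rightarrow> real^'m^'N"
  where "leader_matrix v = (\<chi> i j. if i = v j then 1 else 0)"

definition indexed_partition :: "('k::finite \<Rightarrow> 'N::finite set) \<Rightarrow> bool"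
  where "indexed_partition C \<longleftrightarrow> inj C \<and> partition_on UNIV (range C)"

definition almost_equitable :: "real^'N^'N \<Rightarrow> ('k::finite \<Rightarrow> 'N::finite set) \<Rightarrow> bool"
  where "almost_equitable a C \<longleftrightarrow>
    (\<forall>p q. p \<noteq> q \<longrightarrow>
      (\<forall>j\<in>C q. \<forall>j'\<in>C q. (\<Sum>i\<in>C p. a $ i $ j) = (\<Sum>i\<in>C p. a $ i $ j')))"

definition char_matrix :: "('k::finite \<Rightarrow> 'N::finite set) \<Rightarrow> real^'k^'N"
  where "char_matrix C = (\<chi> i j. if i \<in> C j then 1 else 0)"

definition reduced_laplacian :: "real^'N^'N \<Rightarrow> ('k::finite \<Rightarrow> 'N::finite set) \<Rightarrow> real^'k^'k"
  where "reduced_laplacian a C =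
    matrix_inv (transpose (char_matrix C) ** char_matrix C) **
    transpose (char_matrix C) ** laplacian a ** char_matrix C"

definition reduced_leader_matrix :: "('m::finite \<Rightarrow> 'N::finite) \<Rightarrow> ('k::finite \<Rightarrow> 'N::finite set) \<Rightarrow> real^'m^'k"
  where "reduced_leader_matrix v C =
    matrix_inv (transpose (char_matrix C) ** char_matrix C) **
    transpose (char_matrix C) ** leader_matrix v"

section \<open>Networks\<close>

definition network_state_matrix ::
    "real^'N^'N \<Rightarrow> real^'n^'n \<Rightarrow> real^'n^'n \<Rightarrow> real^('N \<times> 'n)^('N \<times> 'n)"
  where "network_state_matrix L A B = mat 1 \<otimes>\<^sub>K A - L \<otimes>\<^sub>K B"

definition network_tf ::
    "real^'N^'N \<Rightarrow> ('m::finite \<Rightarrow> 'N::finite) \<Rightarrow> real^'n^'n \<Rightarrow> real^'n^'n \<Rightarrow> real^'r^'n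
      \<Rightarrow> ratfun^('m \<times> 'r)^('N \<times> 'n)"
  where "network_tf a v A B E =
    transfer_function
      (network_state_matrix (laplacian a) A B)
      (leader_matrix v \<otimes>\<^sub>K E)
      (laplacian a \<otimes>\<^sub>K mat 1)"

definition reduced_network_tf ::
    "real^'N^'N \<Rightarrow> ('m::finite \<Rightarrow> 'N::finite) \<Rightarrow> ('k::finite \<Rightarrow> 'N::finite set) \<Rightarrow> real^'n^'n \<Rightarrow> real^'n^'n \<Rightarrow> real^'r^'n
      \<Rightarrow> ratfun^('m \<times> 'r)^('N \<times> 'n)"
  where "reduced_network_tf a v C A B E =
    transfer_function
      (network_state_matrix (reduced_laplacian a C) A B)
      (reduced_leader_matrix v C \<otimes>\<^sub>K E)
      ((laplacian a ** char_matrix C) \<otimes>\<^sub>K mat 1)"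

definition auxiliary_tf ::
    "real^'n^'n \<Rightarrow> real^'n^'n \<Rightarrow> real^'r^'n \<Rightarrow> real \<Rightarrow> ratfun^'r^'n"
  where "auxiliary_tf A B E \<mu> = transfer_function (A - \<mu> *\<^sub>R B) E (mat \<mu>)"

definition state_trajectory ::
    "real^'x^'x \<Rightarrow> real^'u^'x \<Rightarrow> (real \<Rightarrow> real^'u) \<Rightarrow> (real \<Rightarrow> real^'x) \<Rightarrow> bool"
  where "state_trajectory F G u x \<longleftrightarrow>
    (\<forall>t\<ge>0. (x has_vector_derivative (F *v x t + G *v u t)) (at t within {0..}))"

definition agent_state :: "real^('N::finite \<times> 'n::finite) \<Rightarrow> 'N \<Rightarrow> real^'n"
  where "agent_state x i = (\<chi> p. x $ (i, p))"

definition synchronized ::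
    "real^'N^'N \<Rightarrow> ('m::finite \<Rightarrow> 'N::finite) \<Rightarrow> real^'n^'n \<Rightarrow> real^'n^'n \<Rightarrow> real^'r^'n \<Rightarrow> bool"
  where "synchronized a v A B E \<longleftrightarrow>
    (\<forall>x. state_trajectory (network_state_matrix (laplacian a) A B)
           (leader_matrix v \<otimes>\<^sub>K E) (\<lambda>t. 0) x \<longrightarrow>
      (\<forall>i j. ((\<lambda>t. agent_state (x t) i - agent_state (x t) j) \<longlongrightarrow> 0) at_top))"

text \<open>
  The difference of the two multisets keeps multiplicities.  Suprema and infima range over finite
  sets, and the supremum over the empty set is \<open>0\<close>.
\<close>
definition S_max ::
    "real^'N^'N \<Rightarrow> ('k::finite \<Rightarrow> 'N::finite set) \<Rightarrow> real^'n^'n \<Rightarrow> real^'n^'n \<Rightarrow> real^'r^'n \<Rightarrow> ennreal"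
  where "S_max a C A B E =
    (SUP \<mu>\<in>set_mset (eigvals (laplacian a) - eigvals (reduced_laplacian a C)).
      hinf_norm (auxiliary_tf A B E \<mu>))"

definition S_min ::
    "real^'N^'N \<Rightarrow> real^'n^'n \<Rightarrow> real^'n^'n \<Rightarrow> real^'r^'n \<Rightarrow> ennreal"
  where "S_min a A B E =
    (INF \<mu>\<in>set_mset (eigvals (laplacian a)) - {0}.
      ennreal (sigma_min (tf_eval (auxiliary_tf A B E \<mu>) 0)))"

end

theory Submission
  imports Defs
begin

text \<open>
  The proof rests on two reductions.

  First, almost equitability says that the functions constant on cells form an \<open>L\<close>-invariant
  subspace, \<open>L P = P L'\<close> with \<open>L'\<close> the reduced Laplacian (\<open>almost_equitable_intertwines\<close>).  Pulling
  \<open>P\<close> through the resolvent of the network shows that the reduced network has the same transfer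
  function as the original network with the leader matrix \<open>M\<close> replaced by its orthogonal projection
  \<open>P M'\<close> onto that subspace (\<open>reduced_transfer\<close>).  Hence \<open>S - S'\<close> is the original network driven
  through the residual \<open>M - P M'\<close>, whose columns are orthogonal to all functions constant on cells.

  Secondly, an eigenvector \<open>b\<close> of \<open>L\<close> with eigenvalue \<open>\<mu>\<close> decouples the network: driven through
  \<open>b x\<^sup>T\<close>, it has the transfer matrix \<open>b x\<^sup>T \<otimes> S\<^sub>\<mu>\<close> (\<open>network_mode_transfer\<close>).  Take an orthonormal
  eigenbasis of the orthogonal complement of the column space of \<open>P\<close>; its eigenvalues are, with
  multiplicity, those of \<open>L\<close> that \<open>L'\<close> lacks (\<open>complementary_eigenbasis\<close>).  Expanding the residual
  in it gives \<open>\<parallel>(S - S')(i\<omega>) z\<parallel>\<^sup>2 = \<Sum>\<^sub>b \<parallel>S\<^sub>\<mu>(i\<omega>) z\<^sub>b\<parallel>\<^sup>2\<close>, where \<open>\<mu>\<close> is the eigenvalue of \<open>b\<close> and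
  the \<open>z\<^sub>b\<close> are the modal coordinates of the input.  So the error is at most \<open>S_max\<close> times the square
  root of the largest possible ratio \<open>\<Sum>\<^sub>b \<parallel>z\<^sub>b\<parallel>\<^sup>2 / \<parallel>z\<parallel>\<^sup>2\<close>.  That ratio is at most \<open>1\<close> by Bessel; when
  the leaders lie in different cells, their residuals \<open>e\<^sub>v - 1\<^sub>C / |C|\<close> are pairwise orthogonal with
  squared norms \<open>1 - 1 / |C|\<close>, which gives the maximum in the bound (\<open>leader_energy_bound\<close>).

  The relative bound follows from \<open>S_min \<le> \<parallel>S\<parallel>\<close> (\<open>S_min_le_hinf_norm\<close>).  At \<open>s = 0\<close> the same modal
  expansion over a full eigenbasis of \<open>L\<close> is fed opposite inputs at two leaders.  Such an input has
  no component along the kernel of \<open>L\<close>, which connectedness makes one-dimensional, so each of its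
  components is amplified at least by \<open>S_min\<close>.

  The matrix identities are proved over the field of rational functions and evaluated only at the
  end: \<open>A\<close> may have eigenvalues on the imaginary axis, so that the state matrix of the network has
  them too although its transfer function has no pole there.  Symmetry of \<open>A\<close> and \<open>B\<close> makes every
  state matrix that occurs on the modes symmetric.  Its resolvent is then a sum of simple fractions
  with real poles.  On a mode with nonzero eigenvalue of \<open>L\<close>, each such pole is the rate of an
  exponential solution of the network along which agents differ, and synchronization forces it to
  decay (\<open>synchronized_mode_stable\<close>).
\<close>

section \<open>Orthonormal eigenbases of self-adjoint maps\<close>

text \<open>
  The eigenvalue is a function \<open>d\<close> of the basis vector, so that images of \<open>d\<close> count eigenvalues
  with multiplicity.
\<close>
definition orthonormal_eigenbasis ::
    "('a::euclidean_space \<Rightarrow> 'a) \<Rightarrow> ('a \<Rightarrow> real) \<Rightarrow> 'a set \<Rightarrow> 'a set \<Rightarrow> bool"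
  where "orthonormal_eigenbasis f d W B \<longleftrightarrow>
    finite B \<and> pairwise orthogonal B \<and> (\<forall>b\<in>B. norm b = 1) \<and> span B = W \<and>
    (\<forall>b\<in>B. f b = d b *\<^sub>R b)"

text \<open>
  A maximizer \<open>b\<close> of the Rayleigh quotient on the unit sphere of the subspace is an eigenvector.
  With \<open>m\<close> the maximum, the form of \<open>g = m - f\<close> is nonnegative on the subspace and vanishes at \<open>b\<close>;
  moving from \<open>b\<close> a little in the direction \<open>- g b\<close> would make it negative unless \<open>g b = 0\<close>.
\<close>
lemma self_adjoint_eigenvector:
  fixes f :: "'a::euclidean_space \<Rightarrow> 'a"
  assumes f: "linear f" and sa: "\<And>x y. f x \<bullet> y = x \<bullet> f y"
    and W: "subspace W" and inv: "f ` W \<subseteq> W" and ne: "W \<noteq> {0}"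
  shows "\<exists>b\<in>W. norm b = 1 \<and> f b = (b \<bullet> f b) *\<^sub>R b"
proof -
  obtain w where w: "w \<in> W" "w \<noteq> 0"
    using ne W subspace_0 by blast
  have "(1 / norm w) *\<^sub>R w \<in> W \<inter> sphere 0 1"
    using w W by (simp add: subspace_scale)
  moreover have "compact (W \<inter> sphere 0 1)"
    using W by (simp add: closed_subspace closed_Int_compact)
  moreover have "continuous_on (W \<inter> sphere 0 1) (\<lambda>x. x \<bullet> f x)"
    by (intro continuous_intros linear_continuous_on linear_conv_bounded_linear[THEN iffD1] f)
  ultimately obtain b where b: "b \<in> W \<inter> sphere 0 1"
    and bmax: "\<And>x. x \<in> W \<inter> sphere 0 1 \<Longrightarrow> x \<bullet> f x \<le> b \<bullet> f b"
    using continuous_attains_sup[of "W \<inter> sphere 0 1" "\<lambda>x. x \<bullet> f x"] by blast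
  define m where "m = b \<bullet> f b"
  define g where "g x = m *\<^sub>R x - f x" for x
  interpret f: linear f by fact
  have g_add: "g (x + t *\<^sub>R y) = g x + t *\<^sub>R g y" for x y t
    by (simp add: g_def f.add f.scale algebra_simps)
  have g_sa: "g x \<bullet> y = x \<bullet> g y" for x y
    by (simp add: g_def inner_diff_left inner_diff_right sa)
  have pos: "0 \<le> x \<bullet> g x" if x: "x \<in> W" for x
  proof (cases "x = 0")
    case False
    let ?y = "(1 / norm x) *\<^sub>R x"
    have "?y \<bullet> f ?y \<le> m"
      unfolding m_def using x W False by (intro bmax) (simp add: subspace_scale)
    also have "?y \<bullet> f ?y = (x \<bullet> f x) / (norm x)\<^sup>2"
      by (simp add: f.scale power2_eq_square)
    finally have "x \<bullet> f x \<le> m * (norm x)\<^sup>2"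
      using False by (simp add: field_simps)
    then show ?thesis
      by (simp add: g_def inner_diff_right power2_norm_eq_inner)
  qed simp
  have "norm b = 1" using b by simp
  then have bb: "b \<bullet> b = 1"
    by (simp add: norm_eq_1)
  have bg: "b \<bullet> g b = 0"
    using bb by (simp add: g_def inner_diff_right m_def)
  have gbW: "g b \<in> W"
    using b W inv unfolding g_def by (auto intro!: subspace_diff subspace_scale)
  define n q where "n = g b \<bullet> g b" and "q = g b \<bullet> g (g b)"
  have q: "q \<ge> 0" unfolding q_def using gbW by (rule pos)
  have key: "0 \<le> 2 * t * n + t\<^sup>2 * q" for t
  proof -
    have "0 \<le> (b + t *\<^sub>R g b) \<bullet> g (b + t *\<^sub>R g b)"
      using b W gbW by (intro pos subspace_add subspace_scale) auto
    also have "\<dots> = 2 * t * n + t\<^sup>2 * q"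
      using bg g_sa[of b "g b"]
      by (simp add: g_add inner_add_left inner_add_right n_def q_def power2_eq_square algebra_simps)
    finally show ?thesis .
  qed
  have "n = 0"
  proof (rule ccontr)
    assume "n \<noteq> 0"
    then have n: "n > 0" unfolding n_def by simp
    \<comment> \<open>The minimum of the quadratic is at \<open>- n / q\<close>; the shift to \<open>q + 1\<close> covers \<open>q = 0\<close>.\<close>
    define r where "r = n / (q + 1)"
    have nr: "n = r * (q + 1)" and r: "r > 0" using n q by (simp_all add: r_def)
    have "2 * (- r) * n + (- r)\<^sup>2 * q = - (r\<^sup>2 * (q + 2))"
      unfolding nr by (simp add: power2_eq_square algebra_simps)
    also have "\<dots> < 0" using r q by simp
    finally show False using key[of "- r"] by simp
  qed
  then have "f b = m *\<^sub>R b" by (simp add: n_def g_def)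
  then show ?thesis using b m_def by auto
qed

text \<open>
  Splitting off one eigenvector leaves its orthogonal complement inside \<open>W\<close>, which is invariant
  because the map is self-adjoint.
\<close>
theorem self_adjoint_orthonormal_eigenbasis:
  fixes f :: "'a::euclidean_space \<Rightarrow> 'a"
  assumes f: "linear f" and sa: "\<And>x y. f x \<bullet> y = x \<bullet> f y"
    and W: "subspace W" and inv: "f ` W \<subseteq> W"
  shows "\<exists>B. orthonormal_eigenbasis f (\<lambda>b. b \<bullet> f b) W B"
  using W inv
proof (induction "dim W" arbitrary: W rule: less_induct)
  case less
  show ?case
  proof (cases "W = {0}")
    case True
    then have "orthonormal_eigenbasis f (\<lambda>b. b \<bullet> f b) W {}"
      by (simp add: orthonormal_eigenbasis_def)
    then show ?thesis ..
  next
    case False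
    then obtain b where b: "b \<in> W" "norm b = 1" "f b = (b \<bullet> f b) *\<^sub>R b"
      using self_adjoint_eigenvector[OF f sa] less.prems by blast
    define V where "V = {y \<in> W. \<forall>x\<in>span {b}. orthogonal x y}"
    have V: "y \<in> V \<longleftrightarrow> y \<in> W \<and> b \<bullet> y = 0" for y
      by (auto simp: V_def orthogonal_def span_singleton)
    have sub: "span {b} \<subseteq> W"
      using b(1) less.prems(1) by (simp add: span_minimal)
    have "dim V + dim (span {b}) = dim W"
      unfolding V_def using dim_subspace_orthogonal_to_vectors[OF _ less.prems(1) sub] by simp
    moreover have "dim (span {b}) = 1"
      using b(2) by (auto simp: dim_eq_card_independent)
    ultimately have dim: "dim V < dim W" by simp
    have "subspace V"
      using less.prems(1) by (auto simp: subspace_def V inner_add_right)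
    moreover have "f ` V \<subseteq> V"
    proof safe
      fix y assume "y \<in> V"
      moreover have "b \<bullet> f y = (b \<bullet> f b) * (b \<bullet> y)"
        using sa[of b y] b(3) by (metis inner_scaleR_left)
      ultimately show "f y \<in> V" using less.prems(2) by (auto simp: V)
    qed
    ultimately obtain B where B: "orthonormal_eigenbasis f (\<lambda>b. b \<bullet> f b) V B"
      using less.hyps[OF dim] by blast
    have BV: "B \<subseteq> V" using B span_superset by (auto simp: orthonormal_eigenbasis_def)
    have "span (insert b B) = W"
    proof
      show "span (insert b B) \<subseteq> W"
        using BV b(1) less.prems(1) by (intro span_minimal) (auto simp: V)
      show "W \<subseteq> span (insert b B)"
      proof
        fix x assume x: "x \<in> W"
        have "x - (b \<bullet> x) *\<^sub>R b \<in> V"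
          using x b less.prems(1)
          by (auto simp: V inner_diff_right norm_eq_1 intro!: subspace_diff subspace_scale)
        then have "x - (b \<bullet> x) *\<^sub>R b \<in> span B"
          using B by (simp add: orthonormal_eigenbasis_def)
        then show "x \<in> span (insert b B)"
          by (auto simp: span_breakdown_eq)
      qed
    qed
    moreover have "pairwise orthogonal (insert b B)"
      using B BV V by (auto simp del: span_superset simp: orthonormal_eigenbasis_def
          pairwise_insert orthogonal_def inner_commute dest!: subsetD)
    ultimately have "orthonormal_eigenbasis f (\<lambda>b. b \<bullet> f b) W (insert b B)"
      using B b by (simp add: orthonormal_eigenbasis_def)
    then show ?thesis ..
  qed
qed

lemma symmetric_orthonormal_eigenbasis:
  fixes F :: "real^'n^'n"
  assumes F: "transpose F = F" and W: "subspace W" and inv: "(\<lambda>x. F *v x) ` W \<subseteq> W"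
  obtains B where "orthonormal_eigenbasis (\<lambda>x. F *v x) (\<lambda>b. b \<bullet> (F *v b)) W B"
proof -
  have "(F *v x) \<bullet> y = x \<bullet> (F *v y)" for x y
    by (metis F dot_lmul_matrix transpose_matrix_vector)
  then show ?thesis
    using self_adjoint_orthonormal_eigenbasis[OF matrix_vector_mul_linear _ W inv] that by blast
qed

lemma orthonormal_inner:
  assumes "pairwise orthogonal B" "\<forall>b\<in>B. norm b = 1" "b \<in> B" "b' \<in> B"
  shows "b \<bullet> b' = (if b = b' then 1 else 0)"
  using assms by (auto simp: pairwise_def orthogonal_def norm_eq_1)

lemma parseval_orthonormal:
  fixes B :: "'a::euclidean_space set"
  assumes "finite B" "pairwise orthogonal B" "\<forall>b\<in>B. norm b = 1" "x \<in> span B"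
  shows "(\<Sum>b\<in>B. (b \<bullet> x)\<^sup>2) = (norm x)\<^sup>2"
proof -
  have "x \<bullet> x = (\<Sum>b\<in>B. (x \<bullet> b) *\<^sub>R b) \<bullet> x"
    using orthonormal_basis_expand[of B x] assms by simp
  also have "\<dots> = (\<Sum>b\<in>B. (x \<bullet> b) * (b \<bullet> x))"
    by (simp only: inner_sum_left inner_scaleR_left)
  also have "\<dots> = (\<Sum>b\<in>B. (b \<bullet> x)\<^sup>2)"
    by (simp add: power2_eq_square inner_commute)
  finally show ?thesis by (simp add: power2_norm_eq_inner)
qed

lemma bessel_inequality:
  fixes B :: "'a::euclidean_space set"
  assumes "finite B" "pairwise orthogonal B" "\<forall>b\<in>B. norm b = 1"
  shows "(\<Sum>b\<in>B. (b \<bullet> x)\<^sup>2) \<le> (norm x)\<^sup>2"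
proof -
  let ?p = "\<Sum>b\<in>B. (b \<bullet> x) *\<^sub>R b"
  have "b \<bullet> (x - ?p) = 0" if "b \<in> B" for b
  proof -
    have "b \<bullet> ?p = (\<Sum>b'\<in>B. (b' \<bullet> x) * (b \<bullet> b'))" by (simp add: inner_sum_right)
    also have "\<dots> = (\<Sum>b'\<in>B. if b = b' then b' \<bullet> x else 0)"
      using that assms by (intro sum.cong) (auto simp: orthonormal_inner[of B])
    finally show ?thesis using that assms(1) by (simp add: inner_diff_right)
  qed
  then have "?p \<bullet> (x - ?p) = 0" by (simp add: inner_sum_left)
  then have "(norm x)\<^sup>2 = (norm (x - ?p))\<^sup>2 + (norm ?p)\<^sup>2"
    using norm_add_Pythagorean[of "x - ?p" ?p] by (simp add: orthogonal_def inner_commute)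
  moreover have "(norm ?p)\<^sup>2 = (\<Sum>b\<in>B. (b \<bullet> x)\<^sup>2)"
    using assms by (subst norm_sum_Pythagorean) (auto simp: pairwise_def orthogonal_def)
  ultimately show ?thesis by simp
qed

lemma orthonormal_basis_resolution:
  fixes B :: "(real^'n) set"
  assumes "finite B" "pairwise orthogonal B" "\<forall>b\<in>B. norm b = 1" "x \<in> span B"
  shows "(\<Sum>b\<in>B. b $ i * (b \<bullet> x)) = x $ i"
proof -
  have "(\<Sum>b\<in>B. (x \<bullet> b) *\<^sub>R b) $ i = x $ i"
    using assms by (subst orthonormal_basis_expand) auto
  then show ?thesis by (simp add: inner_commute mult.commute)
qed

lemma orthonormal_coefficients_norm:
  fixes B :: "(real^'N) set"
  assumes "finite B" "pairwise orthogonal B" "\<forall>b\<in>B. norm b = 1"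
  shows "(\<Sum>i\<in>UNIV. (\<Sum>b\<in>B. b $ i * t b)\<^sup>2) = (\<Sum>b\<in>B. (t b)\<^sup>2)"
proof -
  have "(norm (\<Sum>b\<in>B. t b *\<^sub>R b))\<^sup>2 = (\<Sum>b\<in>B. (t b)\<^sup>2)"
    using assms by (subst norm_sum_Pythagorean) (auto simp: pairwise_def orthogonal_def)
  then show ?thesis
    by (simp add: power2_norm_eq_inner inner_vec_def power2_eq_square[symmetric] mult.commute)
qed

lemma orthonormal_eigenbasis_Un:
  fixes f :: "'a::euclidean_space \<Rightarrow> 'a"
  assumes 1: "orthonormal_eigenbasis f d W B1" and 2: "orthonormal_eigenbasis f d {y. \<forall>x\<in>W. orthogonal x y} B2"
  shows "orthonormal_eigenbasis f d UNIV (B1 \<union> B2)" and "B1 \<inter> B2 = {}"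
proof -
  have span: "span B1 = W" "span B2 = {y. \<forall>x\<in>W. orthogonal x y}"
    and norm: "\<forall>b\<in>B1. norm b = 1"
    using 1 2 unfolding orthonormal_eigenbasis_def by blast+
  have o: "orthogonal b b'" if "b \<in> B1" "b' \<in> B2" for b b'
    using that span span_base[of b B1] span_base[of b' B2] by auto
  show "B1 \<inter> B2 = {}"
    using o norm by (auto simp: orthogonal_def norm_eq_1)
  have "pairwise orthogonal (B1 \<union> B2)"
  proof -
    have "pairwise orthogonal B1" "pairwise orthogonal B2"
      using 1 2 unfolding orthonormal_eigenbasis_def by blast+
    moreover have "orthogonal b' b" if "b \<in> B1" "b' \<in> B2" for b b'
      using o[OF that] by (simp add: orthogonal_commute)
    ultimately show ?thesis using o unfolding pairwise_def by blast
  qed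
  moreover have "span (B1 \<union> B2) = UNIV"
  proof -
    have "x \<in> span (B1 \<union> B2)" for x
    proof -
      obtain y z where yz: "y \<in> span W" "\<And>w. w \<in> span W \<Longrightarrow> orthogonal z w" "x = y + z"
        using orthogonal_subspace_decomp_exists by blast
      have "y \<in> span B1" using yz(1) span(1) by (metis span_span)
      moreover have "z \<in> span B2"
        unfolding span(2) using yz(2) by (auto simp: orthogonal_commute span_base)
      ultimately show ?thesis
        unfolding yz(3) by (intro span_add) (meson span_mono in_mono Un_upper1 Un_upper2)+
    qed
    then show ?thesis by blast
  qed
  ultimately show "orthonormal_eigenbasis f d UNIV (B1 \<union> B2)"
    using 1 2 unfolding orthonormal_eigenbasis_def by blast
qed

section \<open>Eigenvalue multisets and extreme singular values\<close>
lemma mat_mult_vector: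
  fixes v :: "'a::semiring_1^'n"
  shows "mat z *v v = z *s v"
  by (simp add: vec_eq_iff matrix_vector_mult_def mat_def if_distrib[of "\<lambda>t. t * _"] cong: if_cong)

lemma poly_charpoly:
  fixes X :: "'a::comm_ring_1^'n^'n"
  shows "poly (charpoly X) z = det (mat z - X)"
proof -
  have "poly [: - X $ i $ j, if i = j then 1 else 0 :] z = (mat z - X) $ i $ j" for i j
    by (simp add: mat_def)
  then show ?thesis
    unfolding charpoly_def det_def by (simp add: poly_sum poly_prod)
qed

lemma mem_eigvals_iff:
  fixes X :: "'a::field^'n^'n"
  assumes "charpoly X \<noteq> 0"
  shows "z \<in># eigvals X \<longleftrightarrow> (\<exists>v. v \<noteq> 0 \<and> X *v v = z *s v)"
proof -
  have "z \<in># eigvals X \<longleftrightarrow> \<not> invertible (mat z - X)"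
    using assms by (simp add: eigvals_def poly_charpoly invertible_det_nz)
  also have "\<dots> \<longleftrightarrow> (\<exists>v. v \<noteq> 0 \<and> (mat z - X) *v v = 0)"
    by (auto simp: invertible_left_inverse matrix_left_invertible_ker)
  also have "\<dots> \<longleftrightarrow> (\<exists>v. v \<noteq> 0 \<and> X *v v = z *s v)"
    by (simp add: matrix_vector_mult_diff_rdistrib mat_mult_vector) metis
  finally show ?thesis .
qed

text \<open>
  Writing the eigenvectors as columns of an invertible \<open>V\<close>, one has \<open>(z - X) V = V (z - D)\<close> with \<open>D\<close>
  diagonal; comparing determinants for all \<open>z\<close> factors the characteristic polynomial.
\<close>
lemma eigvals_eq_of_eigenbasis:
  fixes X :: "real^'n^'n" and c :: "'n \<Rightarrow> real^'n"
  assumes ind: "\<And>y. (\<Sum>i\<in>UNIV. y $ i *\<^sub>R c i) = 0 \<Longrightarrow> y = 0"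
    and ev: "\<And>i. X *v c i = d i *\<^sub>R c i"
  shows "eigvals X = image_mset d (mset_set UNIV)"
proof -
  define V :: "real^'n^'n" where "V = (\<chi> i j. c j $ i)"
  have col: "column i V = c i" for i by (simp add: V_def column_def vec_eq_iff)
  have "\<forall>y. V *v y = 0 \<longrightarrow> y = 0"
    by (metis (no_types, lifting) ind matrix_mult_sum col scalar_mult_eq_scaleR sum.cong)
  then have "invertible V"
    by (simp add: invertible_left_inverse matrix_left_invertible_ker)
  then have detV: "det V \<noteq> 0" by (simp add: invertible_det_nz)
  have "poly (charpoly X) z = poly (\<Prod>i\<in>UNIV. [:- d i, 1:]) z" for z
  proof -
    define D :: "real^'n^'n" where "D = (\<chi> i j. if i = j then z - d i else 0)"
    have "(mat z - X) ** V = V ** D"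
    proof -
      have "((mat z - X) ** V) $ i $ j = (V ** D) $ i $ j" for i j
      proof -
        have "((mat z - X) ** V) $ i $ j = ((mat z - X) *v c j) $ i"
          by (simp add: matrix_matrix_mult_def matrix_vector_mult_def V_def)
        also have "\<dots> = (z - d j) * c j $ i"
          by (simp add: matrix_vector_mult_diff_rdistrib mat_mult_vector ev algebra_simps)
        also have "\<dots> = (V ** D) $ i $ j"
          by (simp add: matrix_matrix_mult_def V_def D_def if_distrib[of "\<lambda>t. _ * t"] cong: if_cong)
        finally show ?thesis .
      qed
      then show ?thesis by (simp add: vec_eq_iff)
    qed
    then have "det (mat z - X) * det V = det V * det D"
      by (simp only: det_mul[symmetric])
    moreover have "det D = (\<Prod>i\<in>UNIV. z - d i)"
      by (subst det_diagonal) (auto simp: D_def)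
    ultimately show ?thesis using detV by (simp add: poly_charpoly poly_prod)
  qed
  then have "charpoly X = (\<Prod>i\<in>UNIV. [:- d i, 1:])"
    by (simp add: poly_eq_poly_eq_iff[symmetric] fun_eq_iff)
  then show ?thesis
    unfolding eigvals_def by (simp add: proots_prod sum_unfold_sum_mset)
qed

text \<open>
  If \<open>P\<close> is injective and intertwines \<open>K\<close> with \<open>X\<close>, then \<open>K\<close> is the restriction of \<open>X\<close> to the column
  space of \<open>P\<close> in the coordinates given by \<open>P\<close>.  The eigenvectors pulled back to these coordinates
  need not be orthogonal, but they are a basis, which suffices for counting eigenvalues.
\<close>
lemma eigvals_invariant_subspace:
  fixes X :: "real^'n^'n" and P :: "real^'k^'n"
  assumes JP: "J ** P = mat 1" and XP: "X ** P = P ** K"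
    and B: "orthonormal_eigenbasis (\<lambda>x. X *v x) d (range (\<lambda>y. P *v y)) B"
  shows "eigvals K = image_mset d (mset_set B)"
proof -
  have fin: "finite B" and orth: "pairwise orthogonal B" "\<forall>b\<in>B. norm b = 1"
    and span: "span B = range (\<lambda>y. P *v y)" and ev: "\<And>b. b \<in> B \<Longrightarrow> X *v b = d b *\<^sub>R b"
    using B unfolding orthonormal_eigenbasis_def by blast+
  have JPv: "J *v (P *v y) = y" for y
    by (simp add: matrix_vector_mul_assoc JP)
  then have injP: "inj (\<lambda>y. P *v y)" by (rule inj_on_inverseI)
  have "independent B"
    using orth by (intro pairwise_orthogonal_independent) auto
  then have "card B = dim (range (\<lambda>y. P *v y))"
    using dim_eq_card[of B B] by (simp add: span[symmetric])
  also have "\<dots> = CARD('k)"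
    using dim_image_eq[of "\<lambda>y. P *v y" UNIV] injP by simp
  finally obtain f where f: "bij_betw f (UNIV :: 'k set) B"
    using fin finite_same_card_bij[of "UNIV :: 'k set" B] by auto
  then have inj: "inj f" and ran: "range f = B" by (auto simp: bij_betw_def)
  have Pc: "P *v (J *v f i) = f i" for i
  proof -
    have "f i \<in> range (\<lambda>y. P *v y)" using ran span_base[of "f i" B] span by auto
    then show ?thesis using JPv by auto
  qed
  have "eigvals K = image_mset (\<lambda>i. d (f i)) (mset_set UNIV)"
  proof (rule eigvals_eq_of_eigenbasis[where c = "\<lambda>i. J *v f i"])
    fix y :: "real^'k" assume "(\<Sum>i\<in>UNIV. y $ i *\<^sub>R (J *v f i)) = 0"
    then have "P *v (\<Sum>i\<in>UNIV. y $ i *\<^sub>R (J *v f i)) = 0" by simp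
    then have 0: "(\<Sum>i\<in>UNIV. y $ i *\<^sub>R f i) = 0"
      by (simp only: linear_sum[OF matrix_vector_mul_linear] matrix_vector_mult_scaleR Pc)
    have "y $ j = f j \<bullet> (\<Sum>i\<in>UNIV. y $ i *\<^sub>R f i)" for j
    proof -
      have "f j \<bullet> (\<Sum>i\<in>UNIV. y $ i *\<^sub>R f i) = (\<Sum>i\<in>UNIV. if j = i then y $ i else 0)"
        unfolding inner_sum_right using ran inj
        by (intro sum.cong) (auto simp: orthonormal_inner[OF orth] inj_eq)
      then show ?thesis by simp
    qed
    then show "y = 0" by (simp add: 0 vec_eq_iff)
  next
    fix i
    have "P *v (K *v (J *v f i)) = X *v f i"
      by (metis Pc XP matrix_vector_mul_assoc)
    also have "\<dots> = P *v (d (f i) *\<^sub>R (J *v f i))"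
      using ev[of "f i"] ran by (auto simp: matrix_vector_mult_scaleR Pc)
    finally show "K *v (J *v f i) = d (f i) *\<^sub>R (J *v f i)"
      using injP by (simp add: inj_eq)
  qed
  also have "\<dots> = image_mset d (image_mset f (mset_set UNIV))"
    by (simp add: multiset.map_comp comp_def)
  also have "image_mset f (mset_set UNIV) = mset_set B"
    using image_mset_mset_set[OF inj] ran by simp
  finally show ?thesis .
qed

corollary eigvals_orthonormal_eigenbasis:
  fixes X :: "real^'n^'n"
  assumes "orthonormal_eigenbasis (\<lambda>x. X *v x) d UNIV B"
  shows "eigvals X = image_mset d (mset_set B)"
  using assms by (intro eigvals_invariant_subspace[of "mat 1" "mat 1" X]) simp_all

lemma inner_complex_vec: "(x :: complex^'n) \<bullet> y = Re (\<Sum>i\<in>UNIV. x $ i * cnj (y $ i))"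
  by (simp add: inner_vec_def inner_complex_def)

lemma inner_adjoint_matrix:
  fixes Z :: "complex^'n^'m"
  shows "(adjoint_matrix Z *v y) \<bullet> x = y \<bullet> (Z *v x)"
proof -
  have "(\<Sum>i\<in>UNIV. (adjoint_matrix Z *v y) $ i * cnj (x $ i)) =
      (\<Sum>i\<in>UNIV. \<Sum>j\<in>UNIV. y $ j * cnj (Z $ j $ i * x $ i))"
    by (simp add: matrix_vector_mult_def adjoint_matrix_def transpose_def sum_distrib_left sum_distrib_right mult_ac)
  also have "\<dots> = (\<Sum>j\<in>UNIV. \<Sum>i\<in>UNIV. y $ j * cnj (Z $ j $ i * x $ i))"
    by (rule sum.swap)
  also have "\<dots> = (\<Sum>j\<in>UNIV. y $ j * cnj ((Z *v x) $ j))"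
    by (simp add: matrix_vector_mult_def sum_distrib_left)
  finally show ?thesis by (simp add: inner_complex_vec)
qed

lemma norm_gram:
  fixes Z :: "complex^'n^'m"
  shows "(norm (Z *v x))\<^sup>2 = x \<bullet> ((adjoint_matrix Z ** Z) *v x)"
  by (simp only: matrix_vector_mul_assoc[symmetric] inner_commute[of x] inner_adjoint_matrix
      power2_norm_eq_inner)

lemma gram_eigenvector:
  fixes Z :: "complex^'n^'m"
  assumes "(adjoint_matrix Z ** Z) *v x = z *s x"
  shows "(norm (Z *v x))\<^sup>2 = Re z * (norm x)\<^sup>2"
proof -
  have "x \<bullet> (z *s x) = Re z * (x \<bullet> x)"
    by (simp add: inner_vec_def inner_complex_def sum_distrib_left algebra_simps)
  then show ?thesis unfolding norm_gram assms by (simp add: power2_norm_eq_inner)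
qed

text \<open>
  The characteristic polynomial is nonzero because it does not vanish at \<open>-1\<close>: the eigenvalues of
  \<open>Z\<^sup>* Z\<close> are nonnegative.
\<close>
lemma gram_eigvals_iff:
  fixes Z :: "complex^'n^'m"
  shows "z \<in># eigvals (adjoint_matrix Z ** Z) \<longleftrightarrow>
    (\<exists>x. x \<noteq> 0 \<and> (adjoint_matrix Z ** Z) *v x = z *s x)"
proof (rule mem_eigvals_iff)
  have "\<forall>x. (mat (-1) - adjoint_matrix Z ** Z) *v x = 0 \<longrightarrow> x = 0"
  proof safe
    fix x assume "(mat (-1) - adjoint_matrix Z ** Z) *v x = 0"
    then have "(adjoint_matrix Z ** Z) *v x = (-1) *s x"
      by (simp add: matrix_vector_mult_diff_rdistrib mat_mult_vector)
    from gram_eigenvector[OF this] have "(norm (Z *v x))\<^sup>2 + (norm x)\<^sup>2 = 0" by simp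
    then show "x = 0" by (simp add: add_nonneg_eq_0_iff)
  qed
  then have "invertible (mat (-1) - adjoint_matrix Z ** Z)"
    by (simp add: invertible_left_inverse matrix_left_invertible_ker)
  then have "poly (charpoly (adjoint_matrix Z ** Z)) (-1) \<noteq> 0"
    by (simp add: poly_charpoly invertible_det_nz)
  then show "charpoly (adjoint_matrix Z ** Z) \<noteq> 0" by auto
qed

lemma linear_complex_matrix: "linear (\<lambda>x. (X :: complex^'n^'m) *v x)"
proof (rule linearI)
  show "X *v (r *\<^sub>R x) = r *\<^sub>R (X *v x)" for r x
    by (simp add: vec_eq_iff matrix_vector_mult_def scaleR_sum_right)
qed (simp add: matrix_vector_right_distrib)

text \<open>
  The real inner product on complex vectors is the real part of the Hermitian one, so \<open>Z\<^sup>* Z\<close> is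
  self-adjoint as a real-linear map and the real spectral theorem applies to it; its real
  eigenvectors are eigenvectors over the complex numbers.
\<close>
lemma gram_eigenbasis:
  fixes Z :: "complex^'n^'m"
  obtains B :: "(complex^'n) set" and d where "finite B" "B \<noteq> {}"
    "\<And>b. b \<in> B \<Longrightarrow> d b \<in> Re ` set_mset (eigvals (adjoint_matrix Z ** Z))"
    "\<And>x. (norm x)\<^sup>2 = (\<Sum>b\<in>B. (b \<bullet> x)\<^sup>2)"
    "\<And>x. (norm (Z *v x))\<^sup>2 = (\<Sum>b\<in>B. d b * (b \<bullet> x)\<^sup>2)"
proof -
  let ?H = "adjoint_matrix Z ** Z"
  have lin: "linear (\<lambda>x. ?H *v x)"
    by (rule linear_complex_matrix)
  have sa: "(?H *v x) \<bullet> y = x \<bullet> (?H *v y)" for x y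
  proof -
    have "(?H *v x) \<bullet> y = (Z *v x) \<bullet> (Z *v y)" for x y
      by (simp only: matrix_vector_mul_assoc[symmetric] inner_adjoint_matrix)
    then show ?thesis by (metis inner_commute)
  qed
  obtain B d where B: "orthonormal_eigenbasis (\<lambda>x. ?H *v x) d UNIV B"
    using self_adjoint_orthonormal_eigenbasis[OF lin sa subspace_UNIV] by blast
  then have fin: "finite B" and orth: "pairwise orthogonal B" "\<forall>b\<in>B. norm b = 1"
    and span: "span B = UNIV" and ev: "\<And>b. b \<in> B \<Longrightarrow> ?H *v b = d b *\<^sub>R b"
    unfolding orthonormal_eigenbasis_def by blast+
  show ?thesis
  proof (rule that[OF fin])
    have "(axis undefined 1 :: complex^'n) \<noteq> 0" by (simp add: axis_eq_0_iff)
    then show "B \<noteq> {}" using span by (metis UNIV_I empty_iff insert_iff span_empty)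
    show "d b \<in> Re ` set_mset (eigvals ?H)" if "b \<in> B" for b
    proof -
      have "?H *v b = complex_of_real (d b) *s b"
        using ev[OF that] by (simp add: vec_eq_iff scaleR_conv_of_real[where 'a=complex])
      moreover have "b \<noteq> 0" using orth that by auto
      ultimately have "complex_of_real (d b) \<in># eigvals ?H"
        unfolding gram_eigvals_iff by blast
      then show ?thesis by (metis Re_complex_of_real image_eqI)
    qed
    show "(norm x)\<^sup>2 = (\<Sum>b\<in>B. (b \<bullet> x)\<^sup>2)" for x
      using parseval_orthonormal[OF fin orth, of x] span by simp
    show "(norm (Z *v x))\<^sup>2 = (\<Sum>b\<in>B. d b * (b \<bullet> x)\<^sup>2)" for x
    proof -
      have "(\<Sum>b\<in>B. (x \<bullet> b) *\<^sub>R b) = x"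
        using fin orth span by (intro orthonormal_basis_expand) auto
      then have "?H *v x = ?H *v (\<Sum>b\<in>B. (x \<bullet> b) *\<^sub>R b)"
        by (rule arg_cong[OF sym])
      also have "\<dots> = (\<Sum>b\<in>B. (x \<bullet> b) *\<^sub>R (d b *\<^sub>R b))"
        unfolding linear_sum[OF lin] by (rule sum.cong) (simp_all add: linear_scale[OF lin] ev)
      finally have "x \<bullet> (?H *v x) = (\<Sum>b\<in>B. (x \<bullet> b) * (d b * (x \<bullet> b)))"
        by (simp only: inner_sum_right inner_scaleR_right)
      also have "\<dots> = (\<Sum>b\<in>B. d b * (b \<bullet> x)\<^sup>2)"
        by (simp add: power2_eq_square inner_commute mult_ac)
      finally show ?thesis unfolding norm_gram .
    qed
  qed
qed

lemma norm_le_sigma_max: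
  fixes Z :: "complex^'n^'m"
  shows "norm (Z *v x) \<le> sigma_max Z * norm x"
proof -
  obtain B d where B: "finite B" "B \<noteq> {}"
    "\<And>b. b \<in> B \<Longrightarrow> d b \<in> Re ` set_mset (eigvals (adjoint_matrix Z ** Z))"
    "\<And>x. (norm x)\<^sup>2 = (\<Sum>b\<in>B. (b \<bullet> x)\<^sup>2)"
    "\<And>x. (norm (Z *v x))\<^sup>2 = (\<Sum>b\<in>B. d b * (b \<bullet> x)\<^sup>2)"
    using gram_eigenbasis by blast
  let ?M = "Max (Re ` set_mset (eigvals (adjoint_matrix Z ** Z)))"
  have le: "d b \<le> ?M" if "b \<in> B" for b
    using B(3)[OF that] by (intro Max_ge) auto
  have "(norm (Z *v x))\<^sup>2 \<le> (\<Sum>b\<in>B. ?M * (b \<bullet> x)\<^sup>2)"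
    unfolding B(5) by (intro sum_mono mult_right_mono le) auto
  also have "\<dots> = ?M * (norm x)\<^sup>2" by (simp add: B(4) sum_distrib_left)
  finally have "sqrt ((norm (Z *v x))\<^sup>2) \<le> sqrt (?M * (norm x)\<^sup>2)"
    by (rule real_sqrt_le_mono)
  then show ?thesis by (simp add: sigma_max_def real_sqrt_mult)
qed

lemma sigma_min_norm_le:
  fixes Z :: "complex^'n^'m"
  shows "sigma_min Z * norm x \<le> norm (Z *v x)"
proof -
  obtain B d where B: "finite B" "B \<noteq> {}"
    "\<And>b. b \<in> B \<Longrightarrow> d b \<in> Re ` set_mset (eigvals (adjoint_matrix Z ** Z))"
    "\<And>x. (norm x)\<^sup>2 = (\<Sum>b\<in>B. (b \<bullet> x)\<^sup>2)"
    "\<And>x. (norm (Z *v x))\<^sup>2 = (\<Sum>b\<in>B. d b * (b \<bullet> x)\<^sup>2)"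
    using gram_eigenbasis by blast
  let ?M = "Min (Re ` set_mset (eigvals (adjoint_matrix Z ** Z)))"
  have le: "?M \<le> d b" if "b \<in> B" for b
    using B(3)[OF that] by (intro Min_le) auto
  have "?M * (norm x)\<^sup>2 = (\<Sum>b\<in>B. ?M * (b \<bullet> x)\<^sup>2)" by (simp add: B(4) sum_distrib_left)
  also have "\<dots> \<le> (norm (Z *v x))\<^sup>2"
    unfolding B(5) by (intro sum_mono mult_right_mono le) auto
  finally have "sqrt (?M * (norm x)\<^sup>2) \<le> sqrt ((norm (Z *v x))\<^sup>2)"
    by (rule real_sqrt_le_mono)
  then show ?thesis by (simp add: sigma_min_def real_sqrt_mult)
qed

lemma gram_eigvals_nonempty:
  fixes Z :: "complex^'n^'m"
  shows "Re ` set_mset (eigvals (adjoint_matrix Z ** Z)) \<noteq> {}"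
  by (rule gram_eigenbasis[of Z]) (metis ex_in_conv)

lemma gram_eigvals_nonneg:
  fixes Z :: "complex^'n^'m"
  assumes "z \<in># eigvals (adjoint_matrix Z ** Z)"
  shows "0 \<le> Re z"
proof -
  obtain x where "x \<noteq> 0" "(norm (Z *v x))\<^sup>2 = Re z * (norm x)\<^sup>2"
    using assms gram_eigenvector unfolding gram_eigvals_iff by blast
  then have "0 \<le> Re z * (norm x)\<^sup>2" and pos: "0 < (norm x)\<^sup>2"
    using zero_le_power2[of "norm (Z *v x)"] by simp_all
  then show ?thesis by (simp only: zero_le_mult_iff) auto
qed

lemma sigma_min_nonneg: "0 \<le> sigma_min Z"
proof -
  have "Min (Re ` set_mset (eigvals (adjoint_matrix Z ** Z))) \<in> Re ` set_mset (eigvals (adjoint_matrix Z ** Z))"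
    by (intro Min_in gram_eigvals_nonempty) auto
  then show ?thesis using gram_eigvals_nonneg by (auto simp: sigma_min_def)
qed

lemma sigma_max_le:
  fixes Z :: "complex^'n^'m"
  assumes c: "0 \<le> c" and le: "\<And>x. norm (Z *v x) \<le> c * norm x"
  shows "sigma_max Z \<le> c"
proof -
  have "Max (Re ` set_mset (eigvals (adjoint_matrix Z ** Z))) \<in> Re ` set_mset (eigvals (adjoint_matrix Z ** Z))"
    by (intro Max_in gram_eigvals_nonempty) auto
  then obtain z where z: "z \<in># eigvals (adjoint_matrix Z ** Z)"
    and Mz: "Max (Re ` set_mset (eigvals (adjoint_matrix Z ** Z))) = Re z" by auto
  obtain x where x: "x \<noteq> 0" "(norm (Z *v x))\<^sup>2 = Re z * (norm x)\<^sup>2"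
    using z gram_eigenvector unfolding gram_eigvals_iff by blast
  have "(norm (Z *v x))\<^sup>2 \<le> (c * norm x)\<^sup>2" by (intro power_mono le) auto
  then have "Re z \<le> c\<^sup>2" using x by (simp add: power_mult_distrib)
  then have "sqrt (Re z) \<le> c" using c by (metis real_le_lsqrt)
  then show ?thesis unfolding sigma_max_def Mz .
qed

section \<open>Rational functions and resolvents of symmetric matrices\<close>
lemma ratfun_regular_Fract:
  assumes "poly q s \<noteq> 0"
  shows "\<not> ratfun_pole (Fract p q) s" and "ratfun_eval (Fract p q) s = poly p s / poly q s"
proof -
  show "\<not> ratfun_pole (Fract p q) s" using assms by (auto simp: ratfun_pole_def)
  show "ratfun_eval (Fract p q) s = poly p s / poly q s"
    unfolding ratfun_eval_def
  proof (rule the_equality)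
    fix z assume "\<exists>p' q'. poly q' s \<noteq> 0 \<and> Fract p q = Fract p' q' \<and> z = poly p' s / poly q' s"
    then obtain p' q' where 1: "poly q' s \<noteq> 0" "Fract p q = Fract p' q'" "z = poly p' s / poly q' s"
      by blast
    have "q \<noteq> 0" "q' \<noteq> 0" using assms 1 by auto
    then have "p * q' = p' * q" using 1(2) by (simp add: eq_fract)
    then have "poly p s * poly q' s = poly p' s * poly q s" by (metis poly_mult)
    then show "z = poly p s / poly q s" unfolding 1(3) using 1(1) assms by (simp add: frac_eq_eq)
  qed (use assms in blast)
qed

lemma ratfun_regular_cases:
  assumes "\<not> ratfun_pole f s"
  obtains p q where "poly q s \<noteq> 0" "q \<noteq> 0" "f = Fract p q"
  using assms unfolding ratfun_pole_def by (metis poly_0)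

text \<open>
  At a point without poles, evaluation is a ring homomorphism.
\<close>
lemma ratfun_add:
  assumes "\<not> ratfun_pole f s" "\<not> ratfun_pole g s"
  shows "\<not> ratfun_pole (f + g) s" and "ratfun_eval (f + g) s = ratfun_eval f s + ratfun_eval g s"
proof -
  obtain p q where f: "poly q s \<noteq> 0" "q \<noteq> 0" "f = Fract p q"
    using assms(1) by (rule ratfun_regular_cases)
  obtain p' q' where g: "poly q' s \<noteq> 0" "q' \<noteq> 0" "g = Fract p' q'"
    using assms(2) by (rule ratfun_regular_cases)
  have fg: "f + g = Fract (p * q' + p' * q) (q * q')" using f g by simp
  show "\<not> ratfun_pole (f + g) s" unfolding fg using f g by (intro ratfun_regular_Fract) simp
  have "ratfun_eval (f + g) s = poly (p * q' + p' * q) s / poly (q * q') s"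
    unfolding fg using f g by (intro ratfun_regular_Fract) simp
  then show "ratfun_eval (f + g) s = ratfun_eval f s + ratfun_eval g s"
    using f g by (simp add: ratfun_regular_Fract field_simps)
qed

lemma ratfun_mult:
  assumes "\<not> ratfun_pole f s" "\<not> ratfun_pole g s"
  shows "\<not> ratfun_pole (f * g) s" and "ratfun_eval (f * g) s = ratfun_eval f s * ratfun_eval g s"
proof -
  obtain p q where f: "poly q s \<noteq> 0" "q \<noteq> 0" "f = Fract p q"
    using assms(1) by (rule ratfun_regular_cases)
  obtain p' q' where g: "poly q' s \<noteq> 0" "q' \<noteq> 0" "g = Fract p' q'"
    using assms(2) by (rule ratfun_regular_cases)
  have fg: "f * g = Fract (p * p') (q * q')" using f g by simp
  show "\<not> ratfun_pole (f * g) s" unfolding fg using f g by (intro ratfun_regular_Fract) simp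
  have "ratfun_eval (f * g) s = poly (p * p') s / poly (q * q') s"
    unfolding fg using f g by (intro ratfun_regular_Fract) simp
  then show "ratfun_eval (f * g) s = ratfun_eval f s * ratfun_eval g s"
    using f g by (simp add: ratfun_regular_Fract)
qed

lemma ratfun_const_regular:
  "\<not> ratfun_pole (ratfun_const c) s" "ratfun_eval (ratfun_const c) s = of_real c"
  using ratfun_regular_Fract[of 1 s "[:complex_of_real c:]"] by (simp_all add: ratfun_const_def)

lemma ratfun_const_simps [simp]:
  "ratfun_const 0 = 0" "ratfun_const 1 = 1"
  "ratfun_const (x + y) = ratfun_const x + ratfun_const y"
  "ratfun_const (x - y) = ratfun_const x - ratfun_const y"
  "ratfun_const (x * y) = ratfun_const x * ratfun_const y"
  by (simp_all add: ratfun_const_def Zero_fract_def One_fract_def pCons_one mult.commute)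

lemma ratfun_const_sum: "ratfun_const (sum f A) = (\<Sum>a\<in>A. ratfun_const (f a))"
  by (induction A rule: infinite_finite_induct) simp_all

lemma ratfun_sum:
  assumes "\<And>a. a \<in> A \<Longrightarrow> \<not> ratfun_pole (f a) s"
  shows "\<not> ratfun_pole (sum f A) s"
    and "ratfun_eval (sum f A) s = (\<Sum>a\<in>A. ratfun_eval (f a) s)"
proof -
  have "\<not> ratfun_pole (sum f A) s \<and> ratfun_eval (sum f A) s = (\<Sum>a\<in>A. ratfun_eval (f a) s)"
    using assms
    by (induction A rule: infinite_finite_induct)
      (use ratfun_const_regular[of 0 s] in \<open>auto simp: ratfun_add\<close>)
  then show "\<not> ratfun_pole (sum f A) s"
    and "ratfun_eval (sum f A) s = (\<Sum>a\<in>A. ratfun_eval (f a) s)" by auto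
qed

abbreviation const_matrix :: "real^'n^'m \<Rightarrow> ratfun^'n^'m"
  where "const_matrix \<equiv> map_matrix ratfun_const"

abbreviation pencil :: "real^'n^'n \<Rightarrow> ratfun^'n^'n"
  where "pencil F \<equiv> mat (Fract [:0, 1:] 1) - const_matrix F"

lemma const_matrix_mult: "const_matrix (X ** Y) = const_matrix X ** const_matrix Y"
  by (simp add: vec_eq_iff matrix_matrix_mult_def ratfun_const_sum)

lemma const_matrix_diff: "const_matrix (X - Y) = const_matrix X - const_matrix Y"
  by (simp add: vec_eq_iff)

lemma const_matrix_mat: "const_matrix (mat c) = mat (ratfun_const c)"
  by (simp add: vec_eq_iff mat_def)

lemma const_matrix_sum: "const_matrix (sum f A) = (\<Sum>a\<in>A. const_matrix (f a))"
  by (simp add: vec_eq_iff ratfun_const_sum)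

lemma matrix_inverse_unique:
  fixes X :: "'a::field^'n^'n"
  assumes "X ** R = mat 1"
  shows "matrix_inv X = R" "R ** X = mat 1"
proof -
  show "R ** X = mat 1" using assms matrix_left_right_inverse by blast
  then have "invertible X" using assms by (auto simp: invertible_def)
  then have "matrix_inv X ** X = mat 1" unfolding invertible_def matrix_inv_def by (metis (mono_tags, lifting) someI_ex)
  then have "matrix_inv X ** (X ** R) = R" by (simp add: matrix_mul_assoc)
  then show "matrix_inv X = R" by (simp add: assms)
qed

text \<open>
  The spectral form \<open>\<Sum>\<^sub>b b b\<^sup>T / (s - d b)\<close> of the resolvent, as an identity of rational matrices.
\<close>
lemma pencil_inverse:
  fixes F :: "real^'n^'n"
  assumes B: "orthonormal_eigenbasis (\<lambda>x. F *v x) d UNIV B"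
  defines "R \<equiv> \<chi> i j. \<Sum>b\<in>B. ratfun_const (b $ i * b $ j) * Fract 1 [:- complex_of_real (d b), 1:]"
  shows "pencil F ** R = mat 1"
proof -
  let ?r = "\<lambda>b. Fract 1 [:- complex_of_real (d b), 1:]"
  let ?X = "Fract [:0, 1 :: complex:] 1"
  have fin: "finite B" and orth: "pairwise orthogonal B" "\<forall>b\<in>B. norm b = 1"
    and span: "span B = UNIV" and ev: "\<And>b. b \<in> B \<Longrightarrow> F *v b = d b *\<^sub>R b"
    using B unfolding orthonormal_eigenbasis_def by blast+
  have r: "(?X - ratfun_const (d b)) * ?r b = 1" for b
    by (simp add: ratfun_const_def One_fract_def eq_fract)
  have "(pencil F ** R) $ i $ j = (mat 1 :: ratfun^'n^'n) $ i $ j" for i j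
  proof -
    have "(pencil F ** R) $ i $ j =
        (\<Sum>k\<in>UNIV. \<Sum>b\<in>B. pencil F $ i $ k * (ratfun_const (b $ k * b $ j) * ?r b))"
      by (simp add: matrix_matrix_mult_def R_def sum_distrib_left)
    also have "\<dots> = (\<Sum>b\<in>B. \<Sum>k\<in>UNIV. pencil F $ i $ k * (ratfun_const (b $ k * b $ j) * ?r b))"
      by (rule sum.swap)
    also have "\<dots> = (\<Sum>b\<in>B. ratfun_const (b $ i * b $ j))"
    proof (rule sum.cong)
      fix b assume b: "b \<in> B"
      have "(\<Sum>k\<in>UNIV. pencil F $ i $ k * ratfun_const (b $ k)) =
          (\<Sum>k\<in>UNIV. (if i = k then ?X * ratfun_const (b $ k) else 0)) -
          (\<Sum>k\<in>UNIV. ratfun_const (F $ i $ k * b $ k))"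
        unfolding sum_subtractf[symmetric]
        by (rule sum.cong) (auto simp: mat_def algebra_simps)
      also have "(\<Sum>k\<in>UNIV. ratfun_const (F $ i $ k * b $ k)) = ratfun_const ((F *v b) $ i)"
        by (simp add: matrix_vector_mult_def ratfun_const_sum)
      also have "(F *v b) $ i = d b * b $ i" using ev[OF b] by simp
      finally have k: "(\<Sum>k\<in>UNIV. pencil F $ i $ k * ratfun_const (b $ k)) =
          (?X - ratfun_const (d b)) * ratfun_const (b $ i)"
        by (simp add: algebra_simps)
      have "(\<Sum>k\<in>UNIV. pencil F $ i $ k * (ratfun_const (b $ k * b $ j) * ?r b)) =
          (\<Sum>k\<in>UNIV. pencil F $ i $ k * ratfun_const (b $ k)) * (ratfun_const (b $ j) * ?r b)"
        unfolding sum_distrib_right by (rule sum.cong) (simp_all only: ratfun_const_simps mult.assoc)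
      also have "\<dots> = ((?X - ratfun_const (d b)) * ?r b) * (ratfun_const (b $ i) * ratfun_const (b $ j))"
        unfolding k by (simp only: ac_simps)
      finally show "(\<Sum>k\<in>UNIV. pencil F $ i $ k * (ratfun_const (b $ k * b $ j) * ?r b)) =
          ratfun_const (b $ i * b $ j)"
        unfolding r by (simp only: ratfun_const_simps mult_1_left)
    qed simp
    also have "\<dots> = ratfun_const (\<Sum>b\<in>B. b $ i * (b \<bullet> axis j 1))"
      by (simp add: ratfun_const_sum inner_axis)
    also have "(\<Sum>b\<in>B. b $ i * (b \<bullet> axis j 1)) = axis j 1 $ i"
      using fin orth span by (intro orthonormal_basis_resolution) auto
    finally show ?thesis by (simp add: axis_def mat_def)
  qed
  then show ?thesis by (simp add: vec_eq_iff)
qed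

lemma symmetric_pencil_invertible:
  fixes F :: "real^'n^'n"
  assumes "transpose F = F"
  obtains R where "pencil F ** R = mat 1"
proof (rule symmetric_orthonormal_eigenbasis[OF assms subspace_UNIV])
  fix B assume "orthonormal_eigenbasis (\<lambda>x. F *v x) (\<lambda>b. b \<bullet> (F *v b)) UNIV B"
  from pencil_inverse[OF this] show thesis by (rule that)
qed simp

lemma transfer_function_poles:
  fixes F :: "real^'n^'n"
  assumes B: "orthonormal_eigenbasis (\<lambda>x. F *v x) d UNIV B"
    and pole: "tf_pole (transfer_function F G H) s"
  shows "\<exists>b\<in>B. s = complex_of_real (d b)"
proof (rule ccontr)
  assume no: "\<not> (\<exists>b\<in>B. s = complex_of_real (d b))"
  have "\<not> ratfun_pole (Fract 1 [:- complex_of_real (d b), 1:]) s" if "b \<in> B" for b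
    using no that by (intro ratfun_regular_Fract) auto
  then have R: "\<not> ratfun_pole (matrix_inv (pencil F) $ i $ j) s" for i j
    unfolding matrix_inverse_unique(1)[OF pencil_inverse[OF B]] vec_lambda_beta
    by (intro ratfun_sum(1) ratfun_mult(1) ratfun_const_regular)
  have "\<not> ratfun_pole (transfer_function F G H $ i $ j) s" for i j
    unfolding transfer_function_def matrix_matrix_mult_def vec_lambda_beta nth_map_matrix
    by (intro ratfun_sum(1) ratfun_mult(1) ratfun_const_regular R)
  with pole show False by (auto simp: tf_pole_def)
qed

section \<open>Transfer functions of networks\<close>
lemma kron_nth [simp]: "(X \<otimes>\<^sub>K Y) $ i $ j = X $ fst i $ fst j * Y $ snd i $ snd j"
  by (simp add: kron_def)

lemma kron_mult:
  fixes X :: "'a::comm_semiring_1^'b^'c"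
  shows "(X \<otimes>\<^sub>K Y) ** (X' \<otimes>\<^sub>K Y') = (X ** X') \<otimes>\<^sub>K (Y ** Y')"
proof -
  have "((X \<otimes>\<^sub>K Y) ** (X' \<otimes>\<^sub>K Y')) $ i $ j = ((X ** X') \<otimes>\<^sub>K (Y ** Y')) $ i $ j" for i j
  proof -
    have "((X \<otimes>\<^sub>K Y) ** (X' \<otimes>\<^sub>K Y')) $ i $ j =
        (\<Sum>(k, l)\<in>UNIV \<times> UNIV. (X $ fst i $ k * X' $ k $ fst j) * (Y $ snd i $ l * Y' $ l $ snd j))"
      unfolding UNIV_Times_UNIV by (simp add: matrix_matrix_mult_def case_prod_beta mult_ac)
    also have "\<dots> = ((X ** X') \<otimes>\<^sub>K (Y ** Y')) $ i $ j"
      unfolding sum.cartesian_product[symmetric]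
      by (simp add: matrix_matrix_mult_def sum_product)
    finally show ?thesis .
  qed
  then show ?thesis by (simp add: vec_eq_iff)
qed

lemma kron_mat:
  "mat 1 \<otimes>\<^sub>K mat c = (mat c :: 'a::semiring_1^('m::finite \<times> 'n::finite)^('m \<times> 'n))"
  by (auto simp: vec_eq_iff mat_def)

lemma mat_mult_nth:
  fixes X :: "'a::semiring_1^'b^'c"
  shows "(mat k ** X) $ i $ j = k * X $ i $ j"
  by (simp add: matrix_matrix_mult_def mat_def if_distrib[of "\<lambda>t. t * _"] cong: if_cong)

lemma kron_scale:
  fixes X :: "'a::comm_semiring_1^'b^'c"
  shows "(mat k ** X) \<otimes>\<^sub>K Y = X \<otimes>\<^sub>K (mat k ** Y)"
  by (simp add: vec_eq_iff mat_mult_nth mult_ac)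

lemma kron_distribs:
  fixes X X' :: "'a::comm_ring_1^'b^'c"
  shows "X \<otimes>\<^sub>K (Y + Y') = X \<otimes>\<^sub>K Y + X \<otimes>\<^sub>K Y'"
    and "X \<otimes>\<^sub>K (Y - Y') = X \<otimes>\<^sub>K Y - X \<otimes>\<^sub>K Y'"
    and "(X - X') \<otimes>\<^sub>K Y = X \<otimes>\<^sub>K Y - X' \<otimes>\<^sub>K Y"
  by (simp_all add: vec_eq_iff algebra_simps)

lemma kron_sum_left:
  fixes f :: "_ \<Rightarrow> 'a::comm_ring_1^'b^'c"
  shows "sum f S \<otimes>\<^sub>K Y = (\<Sum>s\<in>S. f s \<otimes>\<^sub>K Y)"
  by (simp add: vec_eq_iff sum_distrib_right)

lemma matrix_add_mult_distrib:
  fixes X :: "'a::semiring_1^'c^'d"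
  shows "(X + Y) ** Z = X ** Z + Y ** Z"
  by (simp add: vec_eq_iff matrix_matrix_mult_def algebra_simps sum.distrib)

lemma matrix_diff_ldistrib:
  fixes X :: "'a::ring_1^'c^'d"
  shows "X ** (Y - Z) = X ** Y - X ** Z"
  by (simp add: vec_eq_iff matrix_matrix_mult_def algebra_simps sum_subtractf)

lemma matrix_sum_distrib:
  fixes f :: "_ \<Rightarrow> 'a::semiring_1^'b^'c" and X :: "'a^'c^'d"
  shows "X ** sum f S = (\<Sum>s\<in>S. X ** f s)"
  by (simp add: vec_eq_iff matrix_matrix_mult_def sum_distrib_left)
    (intro allI sum.swap)

lemma const_matrix_kron: "const_matrix (X \<otimes>\<^sub>K Y) = const_matrix X \<otimes>\<^sub>K const_matrix Y"
  by (simp add: vec_eq_iff)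

lemma transpose_kron: "transpose (X \<otimes>\<^sub>K Y) = transpose X \<otimes>\<^sub>K transpose Y"
  by (simp add: vec_eq_iff transpose_def)

lemma transpose_network_state_matrix:
  assumes "transpose L = L" "transpose A = A" "transpose B = B"
  shows "transpose (network_state_matrix L A B) = network_state_matrix L A B"
proof -
  have "transpose (network_state_matrix L A B) =
      transpose (mat 1 \<otimes>\<^sub>K A) - transpose (L \<otimes>\<^sub>K B)"
    by (simp add: network_state_matrix_def transpose_def vec_eq_iff)
  then show ?thesis
    by (simp only: transpose_kron transpose_mat assms network_state_matrix_def)
qed

lemma network_pencil:
  "pencil (network_state_matrix L A B) = mat 1 \<otimes>\<^sub>K pencil A + const_matrix L \<otimes>\<^sub>K const_matrix B"
  by (simp add: network_state_matrix_def const_matrix_diff const_matrix_kron const_matrix_mat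
      kron_distribs kron_mat)

lemma auxiliary_pencil:
  "pencil (A - \<mu> *\<^sub>R B) = pencil A + mat (ratfun_const \<mu>) ** const_matrix B"
  by (simp add: vec_eq_iff mat_mult_nth)

lemma transfer_function_sum:
  "transfer_function F (\<Sum>s\<in>S. U s \<otimes>\<^sub>K E) H = (\<Sum>s\<in>S. transfer_function F (U s \<otimes>\<^sub>K E) H)"
  by (simp only: transfer_function_def const_matrix_sum matrix_sum_distrib)

lemma transfer_function_diff:
  "transfer_function F (G - G') H = transfer_function F G H - transfer_function F G' H"
  by (simp only: transfer_function_def const_matrix_diff matrix_diff_ldistrib)

text \<open>
  On a matrix \<open>U\<close> whose columns are eigenvectors for \<open>\<mu>\<close>, the coupling \<open>L\<close> acts as the scalar \<open>\<mu>\<close>.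
  Hence the network pencil sends \<open>U \<otimes> Y\<close> to \<open>U \<otimes> (s - A + \<mu> B) Y\<close>, and its inverse sends \<open>U \<otimes> E\<close> to
  \<open>U \<otimes> (s - A + \<mu> B)\<^sup>-\<^sup>1 E\<close>.
\<close>
lemma network_mode_transfer:
  fixes L :: "real^'N^'N" and U :: "real^'m^'N" and A B :: "real^'n^'n" and E :: "real^'r^'n"
  assumes sym: "transpose L = L" "transpose A = A" "transpose B = B"
    and U: "L ** U = mat \<mu> ** U"
  shows "transfer_function (network_state_matrix L A B) (U \<otimes>\<^sub>K E) (L \<otimes>\<^sub>K mat 1) =
    const_matrix U \<otimes>\<^sub>K auxiliary_tf A B E \<mu>"
proof -
  let ?M = "pencil (network_state_matrix L A B)" and ?X = "pencil (A - \<mu> *\<^sub>R B)"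
  have tA: "transpose (A - \<mu> *\<^sub>R B) = A - \<mu> *\<^sub>R B"
    using sym(2,3) by (simp add: vec_eq_iff transpose_def)
  obtain R where R: "?M ** R = mat 1"
    using symmetric_pencil_invertible[OF transpose_network_state_matrix[OF sym]] .
  obtain S where S: "?X ** S = mat 1"
    using symmetric_pencil_invertible[OF tA] .
  have cU: "const_matrix L ** const_matrix U = mat (ratfun_const \<mu>) ** const_matrix U"
    by (simp only: const_matrix_mult[symmetric] U) (simp only: const_matrix_mult const_matrix_mat)
  have "?M ** (const_matrix U \<otimes>\<^sub>K Y) = const_matrix U \<otimes>\<^sub>K (?X ** Y)" for Y :: "ratfun^'r^'n"
    by (simp only: network_pencil auxiliary_pencil matrix_add_mult_distrib kron_mult matrix_mul_lid cU
        kron_scale kron_distribs(1) matrix_mul_assoc)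
  then have MU: "?M ** (const_matrix U \<otimes>\<^sub>K (S ** const_matrix E)) = const_matrix U \<otimes>\<^sub>K const_matrix E"
    by (simp only: matrix_mul_assoc S matrix_mul_lid)
  have "R ** (const_matrix U \<otimes>\<^sub>K const_matrix E) =
      R ** (?M ** (const_matrix U \<otimes>\<^sub>K (S ** const_matrix E)))"
    unfolding MU ..
  then have "R ** (const_matrix U \<otimes>\<^sub>K const_matrix E) = const_matrix U \<otimes>\<^sub>K (S ** const_matrix E)"
    unfolding matrix_mul_assoc matrix_inverse_unique(2)[OF R] matrix_mul_lid .
  then have "const_matrix (L \<otimes>\<^sub>K mat 1) ** R ** const_matrix (U \<otimes>\<^sub>K E) =
      (const_matrix L ** const_matrix U) \<otimes>\<^sub>K (S ** const_matrix E)"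
    by (simp only: matrix_mul_assoc[symmetric] const_matrix_kron kron_mult const_matrix_mat
        ratfun_const_simps matrix_mul_lid)
  also have "\<dots> = const_matrix U \<otimes>\<^sub>K (const_matrix (mat \<mu>) ** S ** const_matrix E)"
    by (simp only: cU kron_scale const_matrix_mat matrix_mul_assoc)
  finally show ?thesis
    unfolding transfer_function_def auxiliary_tf_def
    by (simp only: matrix_inverse_unique(1)[OF R] matrix_inverse_unique(1)[OF S])
qed

text \<open>
  The intertwining \<open>L P = P K\<close> passes to the pencils and thence to their inverses, so
  \<open>P\<close> moves from the output side of the reduced network to the input side of the original one.  The
  matrix \<open>K\<close> need not be symmetric; its pencil is invertible because the left inverse \<open>J\<close> of \<open>P\<close>
  supplies, with \<open>R\<close> the resolvent of the original network, the left inverse \<open>J R P\<close>.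
\<close>
lemma reduced_transfer:
  fixes L :: "real^'N^'N" and P :: "real^'k^'N" and A B :: "real^'n^'n" and E :: "real^'r^'n"
    and G :: "real^'m^'k"
  assumes sym: "transpose L = L" "transpose A = A" "transpose B = B"
    and LP: "L ** P = P ** K" and JP: "J ** P = mat 1"
  shows "transfer_function (network_state_matrix K A B) (G \<otimes>\<^sub>K E) ((L ** P) \<otimes>\<^sub>K mat 1) =
    transfer_function (network_state_matrix L A B) ((P ** G) \<otimes>\<^sub>K E) (L \<otimes>\<^sub>K mat 1)"
proof -
  let ?M = "pencil (network_state_matrix L A B)" and ?N = "pencil (network_state_matrix K A B)"
  let ?P = "const_matrix P \<otimes>\<^sub>K (mat 1 :: ratfun^'n^'n)"
    and ?J = "const_matrix J \<otimes>\<^sub>K (mat 1 :: ratfun^'n^'n)"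
  obtain R where R: "?M ** R = mat 1"
    using symmetric_pencil_invertible[OF transpose_network_state_matrix[OF sym]] .
  have int: "?M ** ?P = ?P ** ?N"
    by (simp only: network_pencil matrix_add_mult_distrib matrix_add_ldistrib kron_mult matrix_mul_lid
        matrix_mul_rid const_matrix_mult[symmetric] LP)
  have J1: "?J ** ?P = mat 1"
    by (simp only: kron_mult matrix_mul_lid const_matrix_mult[symmetric] JP const_matrix_mat
        ratfun_const_simps kron_mat)
  have "R ** ?P ** ?N = (R ** ?M) ** ?P"
    by (simp only: matrix_mul_assoc[symmetric] int)
  then have RP: "R ** ?P ** ?N = ?P"
    by (simp only: matrix_inverse_unique(2)[OF R] matrix_mul_lid)
  have "(?J ** R ** ?P) ** ?N = ?J ** (R ** ?P ** ?N)"
    by (simp only: matrix_mul_assoc)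
  then have "(?J ** R ** ?P) ** ?N = mat 1"
    by (simp only: RP J1)
  then have N: "?N ** (?J ** R ** ?P) = mat 1"
    using matrix_left_right_inverse by blast
  have "?P ** (?J ** R ** ?P) = R ** ?P ** (?N ** (?J ** R ** ?P))"
    unfolding matrix_mul_assoc RP ..
  then have PN: "?P ** matrix_inv ?N = R ** ?P"
    unfolding matrix_inverse_unique(1)[OF N] N by (simp only: matrix_mul_rid)
  have "const_matrix ((L ** P) \<otimes>\<^sub>K mat 1) = const_matrix (L \<otimes>\<^sub>K mat 1) ** ?P"
    by (simp only: const_matrix_kron kron_mult const_matrix_mult const_matrix_mat
        ratfun_const_simps matrix_mul_lid)
  moreover have "const_matrix ((P ** G) \<otimes>\<^sub>K E) = ?P ** const_matrix (G \<otimes>\<^sub>K E)"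
    by (simp only: const_matrix_kron kron_mult const_matrix_mult matrix_mul_lid)
  moreover have "(const_matrix (L \<otimes>\<^sub>K mat 1) ** ?P) ** matrix_inv ?N ** const_matrix (G \<otimes>\<^sub>K E) =
      const_matrix (L \<otimes>\<^sub>K mat 1) ** (?P ** matrix_inv ?N) ** const_matrix (G \<otimes>\<^sub>K E)"
    by (simp only: matrix_mul_assoc)
  ultimately show ?thesis
    unfolding transfer_function_def matrix_inverse_unique(1)[OF R]
    by (simp only: PN matrix_mul_assoc)
qed

section \<open>Laplacians and almost equitable partitions\<close>
lemma laplacian_mult_nth:
  assumes "weighted_graph a"
  shows "(laplacian a *v x) $ i = (\<Sum>j\<in>UNIV. a $ i $ j * (x $ i - x $ j))"
proof -
  have "(laplacian a *v x) $ i =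
      (\<Sum>j\<in>UNIV. (if i = j then (\<Sum>l\<in>UNIV. a $ i $ l) * x $ j else 0) - a $ i $ j * x $ j)"
    unfolding matrix_vector_mult_def vec_lambda_beta
    using assms by (intro sum.cong) (auto simp: laplacian_def weighted_graph_def)
  then show ?thesis
    by (simp add: sum_subtractf algebra_simps sum_distrib_left)
qed

lemma transpose_laplacian:
  assumes "weighted_graph a"
  shows "transpose (laplacian a) = laplacian a"
  using assms by (auto simp: vec_eq_iff transpose_def laplacian_def weighted_graph_def)

text \<open>
  The Dirichlet form \<open>\<Sum>\<^sub>i\<^sub>j a\<^sub>i\<^sub>j (x\<^sub>i - x\<^sub>j)\<^sup>2\<close> vanishes on the kernel, so \<open>x\<close> agrees along every edge.
\<close>
lemma laplacian_kernel:
  assumes g: "weighted_graph a" "connected_graph a" and 0: "laplacian a *v x = 0"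
  shows "x $ i = x $ j"
proof -
  have sym: "a $ i $ j = a $ j $ i" and nn: "0 \<le> a $ i $ j" for i j
    using g by (auto simp: weighted_graph_def)
  have "(\<Sum>i\<in>UNIV. \<Sum>j\<in>UNIV. a $ i $ j * (x $ i - x $ j)\<^sup>2) =
      (\<Sum>i\<in>UNIV. \<Sum>j\<in>UNIV. x $ i * (a $ i $ j * (x $ i - x $ j))) +
      (\<Sum>i\<in>UNIV. \<Sum>j\<in>UNIV. x $ j * (a $ i $ j * (x $ j - x $ i)))"
    unfolding sum.distrib[symmetric]
    by (intro sum.cong) (auto simp: power2_eq_square algebra_simps)
  also have "(\<Sum>i\<in>UNIV. \<Sum>j\<in>UNIV. x $ j * (a $ i $ j * (x $ j - x $ i))) =
      (\<Sum>j\<in>UNIV. \<Sum>i\<in>UNIV. x $ j * (a $ j $ i * (x $ j - x $ i)))"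
    by (subst sum.swap) (simp add: sym)
  also have "(\<Sum>i\<in>UNIV. \<Sum>j\<in>UNIV. x $ i * (a $ i $ j * (x $ i - x $ j))) = 0"
    using 0 laplacian_mult_nth[OF g(1), of x] by (simp add: sum_distrib_left[symmetric])
  finally have "(\<Sum>i\<in>UNIV. \<Sum>j\<in>UNIV. a $ i $ j * (x $ i - x $ j)\<^sup>2) = 0" by simp
  then have z: "a $ i $ j * (x $ i - x $ j)\<^sup>2 = 0" for i j
    using nn by (simp add: sum_nonneg_eq_0_iff sum_nonneg)
  have "(i, j) \<in> {(p, q). 0 < a $ p $ q}\<^sup>*"
    using g(2) by (simp add: connected_graph_def)
  then show ?thesis
  proof induction
    case (step p q)
    then show ?case using z[of p q] by simp
  qed simp
qed

lemma indexed_partition_cell: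
  assumes "indexed_partition C"
  obtains q where "\<And>p. i \<in> C p \<longleftrightarrow> p = q"
proof -
  have "i \<in> \<Union>(range C)" using assms by (simp add: indexed_partition_def partition_on_def)
  then obtain q where q: "i \<in> C q" by blast
  have "i \<in> C p \<longleftrightarrow> p = q" for p
  proof
    assume "i \<in> C p"
    then have "C p = C q"
      using assms q by (auto simp: indexed_partition_def partition_on_def disjoint_def)
    then show "p = q" using assms by (simp add: indexed_partition_def inj_eq)
  qed (use q in simp)
  then show ?thesis by (rule that)
qed

lemma indexed_partition_nonempty:
  assumes "indexed_partition C"
  shows "C p \<noteq> {}"
  using assms by (auto simp: indexed_partition_def partition_on_def)

lemma char_matrix_mult_nth:
  fixes K :: "real^'m^'k"
  assumes C: "indexed_partition C" and i: "i \<in> C q"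
  shows "(char_matrix C ** K) $ i $ p = K $ q $ p"
proof -
  obtain q' where q': "\<And>p. i \<in> C p \<longleftrightarrow> p = q'" using indexed_partition_cell[OF C, of i] by blast
  have "q' = q" using q' i by simp
  then show ?thesis
    by (simp add: matrix_matrix_mult_def char_matrix_def q' if_distrib[of "\<lambda>t. t * _"] cong: if_cong)
qed

lemma char_matrix_gram:
  assumes C: "indexed_partition C"
  shows "transpose (char_matrix C) ** char_matrix C =
    (\<chi> p q. if p = q then real (card (C p)) else 0)"
proof -
  have "(\<Sum>i\<in>UNIV. (if i \<in> C p then 1 else 0) * (if i \<in> C q then 1 else 0 :: real)) =
      (if p = q then real (card (C p)) else 0)" for p q
  proof -
    have "(\<Sum>i\<in>UNIV. (if i \<in> C p then 1 else 0) * (if i \<in> C q then 1 else 0 :: real)) =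
        (\<Sum>i\<in>UNIV. if i \<in> C p \<inter> C q then 1 else 0)"
      by (rule sum.cong) auto
    also have "\<dots> = real (card (C p \<inter> C q))" by (simp add: sum.If_cases Int_def)
    also have "C p \<inter> C q = (if p = q then C p else {})"
      using indexed_partition_cell[OF C] by (auto, metis)
    finally show ?thesis by simp
  qed
  then show ?thesis
    by (simp add: vec_eq_iff matrix_matrix_mult_def transpose_def char_matrix_def)
qed

text \<open>
  The pseudoinverse of the characteristic matrix: it averages a function over each cell.
\<close>
definition cell_average :: "('k::finite \<Rightarrow> 'N::finite set) \<Rightarrow> real^'N^'k"
  where "cell_average C = matrix_inv (transpose (char_matrix C) ** char_matrix C) ** transpose (char_matrix C)"

lemma cell_average_char_matrix:
  fixes C :: "'k::finite \<Rightarrow> 'N::finite set"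
  assumes C: "indexed_partition C"
  shows "cell_average C ** char_matrix C = mat 1"
    and "transpose (char_matrix C) ** char_matrix C ** cell_average C = transpose (char_matrix C)"
proof -
  let ?G = "transpose (char_matrix C) ** char_matrix C"
  let ?D = "\<chi> p q. if p = q then 1 / real (card (C p)) else 0 :: real^'k^'k"
  have "card (C p) \<noteq> 0" for p using indexed_partition_nonempty[OF C] by (simp add: card_eq_0_iff)
  then have "?G ** ?D = mat 1"
    unfolding char_matrix_gram[OF C]
    by (auto simp: vec_eq_iff matrix_matrix_mult_def mat_def if_distrib[of "\<lambda>t. t * _"] cong: if_cong)
  note G = matrix_inverse_unique[OF this] this
  show "cell_average C ** char_matrix C = mat 1"
    unfolding cell_average_def matrix_mul_assoc[symmetric] by (simp only: G(1,2))
  show "?G ** cell_average C = transpose (char_matrix C)"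
    unfolding cell_average_def by (simp only: matrix_mul_assoc G(1,3) matrix_mul_lid)
qed

text \<open>
  Every column of \<open>L P\<close> is constant on cells: off the cell of the column this is almost
  equitability, and on that cell it follows because the rows of \<open>L P\<close> sum to zero.  So
  \<open>L P = P K\<close> for some \<open>K\<close>, and multiplying by the pseudoinverse of \<open>P\<close> identifies \<open>K\<close>.
\<close>
lemma almost_equitable_intertwines:
  fixes C :: "'k::finite \<Rightarrow> 'N::finite set"
  assumes g: "weighted_graph a" and C: "indexed_partition C" "almost_equitable a C"
  shows "laplacian a ** char_matrix C = char_matrix C ** reduced_laplacian a C"
proof -
  let ?LP = "laplacian a ** char_matrix C"
  have LP: "?LP $ j $ p = (\<Sum>l\<in>UNIV. a $ j $ l * ((if j \<in> C p then 1 else 0) - (if l \<in> C p then 1 else 0)))" for j p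
  proof -
    have "?LP $ j $ p = (laplacian a *v column p (char_matrix C)) $ j"
      by (simp add: matrix_matrix_mult_def matrix_vector_mult_def column_def)
    then show ?thesis by (simp add: laplacian_mult_nth[OF g] column_def char_matrix_def)
  qed
  have off: "?LP $ j $ p = ?LP $ j' $ p" if "p \<noteq> q" "j \<in> C q" "j' \<in> C q" for j j' p q
  proof -
    have *: "?LP $ j $ p = - (\<Sum>i\<in>C p. a $ i $ j)" if "j \<in> C q" for j
    proof -
      obtain r where "\<And>p. j \<in> C p \<longleftrightarrow> p = r" using indexed_partition_cell[OF C(1), of j] by blast
      then have "j \<notin> C p" using \<open>p \<noteq> q\<close> that by simp
      then have "?LP $ j $ p = - (\<Sum>l\<in>UNIV. if l \<in> C p then a $ j $ l else 0)"
        unfolding LP sum_negf[symmetric] by (intro sum.cong) auto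
      also have "\<dots> = - (\<Sum>i\<in>C p. a $ j $ i)" by (simp add: sum.If_cases)
      also have "\<dots> = - (\<Sum>i\<in>C p. a $ i $ j)" using g by (simp add: weighted_graph_def)
      finally show ?thesis .
    qed
    have "(\<Sum>i\<in>C p. a $ i $ j) = (\<Sum>i\<in>C p. a $ i $ j')"
      using that C(2) unfolding almost_equitable_def by blast
    then show ?thesis by (simp only: *[OF that(2)] *[OF that(3)])
  qed
  have row: "(\<Sum>p\<in>UNIV. ?LP $ j $ p) = 0" for j
  proof -
    have one: "(\<Sum>p\<in>UNIV. if l \<in> C p then 1 else 0 :: real) = 1" for l
    proof -
      obtain q where "\<And>p. l \<in> C p \<longleftrightarrow> p = q" using indexed_partition_cell[OF C(1), of l] by blast
      then show ?thesis by simp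
    qed
    show ?thesis
      unfolding LP by (subst sum.swap) (simp add: sum_distrib_left[symmetric] sum_subtractf one)
  qed
  have const: "?LP $ j $ p = ?LP $ j' $ p" if j: "j \<in> C q" "j' \<in> C q" for j j' p q
  proof (cases "p = q")
    case True
    have neg: "?LP $ j $ p = - (\<Sum>r\<in>UNIV - {p}. ?LP $ j $ r)" for j
      using row[of j] by (simp add: sum.remove[of UNIV p])
    have "(\<Sum>r\<in>UNIV - {p}. ?LP $ j $ r) = (\<Sum>r\<in>UNIV - {p}. ?LP $ j' $ r)"
    proof (rule sum.cong)
      fix r assume "r \<in> UNIV - {p}"
      then have "r \<noteq> q" using True by simp
      then show "?LP $ j $ r = ?LP $ j' $ r" using j by (rule off)
    qed simp
    then show ?thesis by (simp only: neg[of j] neg[of j'])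
  qed (use off j in blast)
  define K :: "real^'k^'k" where "K = (\<chi> q p. ?LP $ (SOME j. j \<in> C q) $ p)"
  have K: "?LP = char_matrix C ** K"
  proof -
    have "?LP $ j $ p = (char_matrix C ** K) $ j $ p" for j p
    proof -
      obtain q where q: "\<And>p. j \<in> C p \<longleftrightarrow> p = q" using indexed_partition_cell[OF C(1), of j] by blast
      then have j: "j \<in> C q" by simp
      have "?LP $ j $ p = ?LP $ (SOME j. j \<in> C q) $ p"
        using j someI[of "\<lambda>j. j \<in> C q", OF j] by (rule const)
      also have "\<dots> = (char_matrix C ** K) $ j $ p"
        unfolding char_matrix_mult_nth[OF C(1) j] by (simp only: K_def vec_lambda_beta)
      finally show ?thesis .
    qed
    then show ?thesis by (simp add: vec_eq_iff)
  qed
  have "reduced_laplacian a C = cell_average C ** ?LP"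
    by (simp add: reduced_laplacian_def cell_average_def matrix_mul_assoc)
  also have "\<dots> = K"
    unfolding K matrix_mul_assoc cell_average_char_matrix(1)[OF C(1)] by simp
  finally show ?thesis using K by simp
qed

text \<open>
  Eigenbases of the column space of \<open>P\<close> and of its orthogonal complement together list the
  eigenvalues of \<open>L\<close>; the first of them lists those of the reduced Laplacian.  Counting them this
  way settles the multiplicities in the difference of the two spectra.
\<close>
lemma complementary_eigenbasis:
  fixes a :: "real^'N^'N" and C :: "'k::finite \<Rightarrow> 'N set"
  assumes g: "weighted_graph a"
    and C: "indexed_partition C" "almost_equitable a C"
  obtains d S where
    "orthonormal_eigenbasis (\<lambda>x. laplacian a *v x) d
      {y. \<forall>x\<in>range (\<lambda>z. char_matrix C *v z). orthogonal x y} S"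
    "eigvals (laplacian a) - eigvals (reduced_laplacian a C) = image_mset d (mset_set S)"
proof -
  let ?L = "laplacian a" and ?P = "char_matrix C" and ?K = "reduced_laplacian a C"
  define d where "d b = b \<bullet> (?L *v b)" for b
  let ?W = "range (\<lambda>z. ?P *v z)"
  let ?V = "{y. \<forall>x\<in>?W. orthogonal x y}"
  have LP: "?L *v (?P *v z) = ?P *v (?K *v z)" for z
    using almost_equitable_intertwines[OF g C] by (simp add: matrix_vector_mul_assoc)
  have sym: "transpose ?L = ?L" by (rule transpose_laplacian[OF g])
  have sa: "(?L *v x) \<bullet> y = x \<bullet> (?L *v y)" for x y
    by (metis sym dot_lmul_matrix transpose_matrix_vector)
  have W: "subspace ?W"
    by (intro linear_subspace_image subspace_UNIV matrix_vector_mul_linear)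
  have V: "subspace ?V"
    by (auto simp: subspace_def orthogonal_clauses)
  obtain B1 where B1: "orthonormal_eigenbasis (\<lambda>x. ?L *v x) d ?W B1"
    unfolding d_def[abs_def]
    by (rule symmetric_orthonormal_eigenbasis[OF sym W]) (auto simp: LP)
  obtain B2 where B2: "orthonormal_eigenbasis (\<lambda>x. ?L *v x) d ?V B2"
    unfolding d_def[abs_def]
    by (rule symmetric_orthonormal_eigenbasis[OF sym V])
      (auto simp: orthogonal_def sa[symmetric] LP)
  note B = orthonormal_eigenbasis_Un[OF B1 B2]
  have fin: "finite B1" "finite B2"
    using B1 B2 unfolding orthonormal_eigenbasis_def by blast+
  have L: "eigvals ?L = image_mset d (mset_set (B1 \<union> B2))"
    by (rule eigvals_orthonormal_eigenbasis[OF B(1)])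
  have K: "eigvals ?K = image_mset d (mset_set B1)"
    by (rule eigvals_invariant_subspace[OF cell_average_char_matrix(1)[OF C(1)]
        almost_equitable_intertwines[OF g C] B1])
  have "eigvals ?L - eigvals ?K = image_mset d (mset_set B2)"
    unfolding L K by (simp add: mset_set_Union[OF fin B(2)])
  with B2 show ?thesis by (rule that)
qed

section \<open>Modal expansion of the leader matrix\<close>

text \<open>
  The part of the leader matrix along the unit vector \<open>b\<close>, that is \<open>b b\<^sup>T M\<close>.
\<close>
definition mode_matrix :: "('m::finite \<Rightarrow> 'N::finite) \<Rightarrow> real^'N \<Rightarrow> real^'m^'N"
  where "mode_matrix v b = (\<chi> i j. b $ i * b $ v j)"

lemma mode_matrix_eigen:
  assumes "L *v b = \<mu> *\<^sub>R b"
  shows "L ** mode_matrix v b = mat \<mu> ** mode_matrix v b"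
proof -
  have "(L ** mode_matrix v b) $ i $ j = (L *v b) $ i * b $ v j" for i j
    by (simp add: matrix_matrix_mult_def matrix_vector_mult_def mode_matrix_def sum_distrib_right
        mult.assoc)
  then show ?thesis
    using assms by (simp add: vec_eq_iff mat_mult_nth) (simp add: mode_matrix_def mult.assoc)
qed

lemma leader_matrix_modes:
  assumes "orthonormal_eigenbasis f d UNIV B"
  shows "leader_matrix v = (\<Sum>b\<in>B. mode_matrix v b)"
proof -
  have "(\<Sum>b\<in>B. b $ i * (b \<bullet> axis (v j) 1)) = axis (v j) 1 $ i" for i j
    using assms unfolding orthonormal_eigenbasis_def by (intro orthonormal_basis_resolution) auto
  then show ?thesis
    by (simp add: vec_eq_iff leader_matrix_def mode_matrix_def inner_axis)
      (simp add: axis_def)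
qed

text \<open>
  Each column of the residual is \<open>e\<^sub>v\<close> minus its projection onto the column space of \<open>P\<close>, hence lies
  in the span of \<open>B\<close>; its coordinates are those of \<open>e\<^sub>v\<close> because \<open>B\<close> is orthogonal to the projection.
\<close>
lemma leader_residual_modes:
  fixes C :: "'k::finite \<Rightarrow> 'N::finite set"
  assumes C: "indexed_partition C"
    and B: "orthonormal_eigenbasis f d {y. \<forall>x\<in>range (\<lambda>z. char_matrix C *v z). orthogonal x y} B"
  shows "leader_matrix v - char_matrix C ** reduced_leader_matrix v C = (\<Sum>b\<in>B. mode_matrix v b)"
proof -
  let ?P = "char_matrix C"
  have span: "span B = {y. \<forall>x\<in>range (\<lambda>z. ?P *v z). orthogonal x y}"
    using B unfolding orthonormal_eigenbasis_def by blast
  have "(\<Sum>b\<in>B. b $ i * b $ v j) = (leader_matrix v - ?P ** reduced_leader_matrix v C) $ i $ j" for i j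
  proof -
    let ?e = "axis (v j) 1 :: real^'N"
    let ?q = "?P *v (cell_average C *v ?e)"
    have "?e - ?q \<in> span B"
      unfolding span
    proof safe
      fix z
      have "(?P *v z) \<bullet> ?e = z \<bullet> (transpose ?P *v ?e)"
        by (metis dot_lmul_matrix inner_commute transpose_matrix_vector)
      moreover have "(?P *v z) \<bullet> ?q = z \<bullet> (transpose ?P *v ?q)"
        by (metis dot_lmul_matrix inner_commute transpose_matrix_vector)
      moreover have "transpose ?P *v ?q = transpose ?P *v ?e"
        using cell_average_char_matrix(2)[OF C] by (simp add: matrix_vector_mul_assoc matrix_mul_assoc)
      ultimately show "orthogonal (?P *v z) (?e - ?q)"
        by (simp add: orthogonal_def inner_diff_right)
    qed
    then have "(?e - ?q) $ i = (\<Sum>b\<in>B. b $ i * (b \<bullet> (?e - ?q)))"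
      using B unfolding orthonormal_eigenbasis_def by (intro orthonormal_basis_resolution[symmetric]) auto
    also have "\<dots> = (\<Sum>b\<in>B. b $ i * b $ v j)"
    proof (rule sum.cong)
      fix b assume "b \<in> B"
      then have "b \<in> span B" by (rule span_base)
      then have "b \<bullet> ?q = 0" unfolding span by (auto simp: orthogonal_def inner_commute)
      then show "b $ i * (b \<bullet> (?e - ?q)) = b $ i * b $ v j"
        by (simp add: inner_diff_right inner_axis)
    qed simp
    finally have "(?e - ?q) $ i = (\<Sum>b\<in>B. b $ i * b $ v j)" .
    moreover have "?q $ i = (?P ** reduced_leader_matrix v C) $ i $ j"
    proof -
      have "cell_average C *v ?e = (\<chi> p. reduced_leader_matrix v C $ p $ j)"
        unfolding reduced_leader_matrix_def cell_average_def[symmetric]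
        by (simp add: vec_eq_iff matrix_vector_mult_def matrix_matrix_mult_def leader_matrix_def axis_def)
      then show ?thesis by (simp add: matrix_matrix_mult_def matrix_vector_mult_def)
    qed
    ultimately show ?thesis
      by (simp add: leader_matrix_def axis_def)
  qed
  then show ?thesis by (simp add: vec_eq_iff mode_matrix_def)
qed

lemma network_mode_sum:
  fixes L :: "real^'N^'N" and A B :: "real^'n^'n" and E :: "real^'r^'n"
  assumes sym: "transpose L = L" "transpose A = A" "transpose B = B"
    and S: "orthonormal_eigenbasis (\<lambda>x. L *v x) d W S"
  shows "transfer_function (network_state_matrix L A B) ((\<Sum>b\<in>S. mode_matrix v b) \<otimes>\<^sub>K E) (L \<otimes>\<^sub>K mat 1) =
    (\<Sum>b\<in>S. const_matrix (mode_matrix v b) \<otimes>\<^sub>K auxiliary_tf A B E (d b))"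
proof -
  have "L ** mode_matrix v b = mat (d b) ** mode_matrix v b" if "b \<in> S" for b
    using S that unfolding orthonormal_eigenbasis_def by (intro mode_matrix_eigen) blast
  then show ?thesis
    unfolding kron_sum_left transfer_function_sum
    by (intro sum.cong network_mode_transfer[OF sym]) auto
qed

definition cell_indicator :: "'N::finite set \<Rightarrow> real^'N"
  where "cell_indicator X = (\<chi> i. if i \<in> X then 1 else 0)"

lemma inner_cell_indicator: "cell_indicator X \<bullet> cell_indicator Y = real (card (X \<inter> Y))"
proof -
  have "cell_indicator X \<bullet> cell_indicator Y = (\<Sum>i\<in>UNIV. if i \<in> X \<inter> Y then 1 else 0)"
    unfolding inner_vec_def by (intro sum.cong) (auto simp: cell_indicator_def)
  then show ?thesis by (simp add: sum.If_cases Int_def)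
qed

lemma cell_indicator_in_range: "cell_indicator (C p) \<in> range (\<lambda>z. char_matrix C *v z)"
proof -
  have "char_matrix C *v axis p 1 = cell_indicator (C p)"
    by (simp add: matrix_vector_mult_basis column_def char_matrix_def cell_indicator_def vec_eq_iff)
  then show ?thesis by (metis rangeI)
qed

text \<open>
  The vectors of \<open>B\<close> are orthogonal to the cell indicators, so each leader vector \<open>e\<^sub>v\<close> may be
  shifted by a multiple of the indicator of its cell without changing the sums on the left.  With
  different cells the best shift makes the shifted vectors \<open>h j\<close> pairwise orthogonal and short;
  otherwise the unshifted vectors are used.  Bessel and Pythagoras then give the bound.
\<close>
lemma leader_energy_bound:
  fixes B :: "(real^'N) set" and v :: "'m::finite \<Rightarrow> 'N" and C :: "'k::finite \<Rightarrow> 'N set"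
  assumes fin: "finite B" and orth: "pairwise orthogonal B" "\<forall>b\<in>B. norm b = 1"
    and perp: "\<And>b x. b \<in> B \<Longrightarrow> x \<in> range (\<lambda>z. char_matrix C *v z) \<Longrightarrow> orthogonal x b"
    and C: "indexed_partition C" and v: "inj v" and \<kappa>: "\<And>i. v i \<in> C (\<kappa> i)"
  shows "(\<Sum>b\<in>B. (\<Sum>j\<in>UNIV. b $ v j * y j)\<^sup>2) \<le>
    (if inj \<kappa> then (MAX i. 1 - 1 / real (card (C (\<kappa> i)))) else 1) * (\<Sum>j\<in>UNIV. (y j)\<^sup>2)"
proof -
  define t where "t j = (if inj \<kappa> then 1 / real (card (C (\<kappa> j))) else 0)" for j
  define h where "h j = axis (v j) 1 - t j *\<^sub>R cell_indicator (C (\<kappa> j))" for j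
  let ?c = "if inj \<kappa> then (MAX i. 1 - 1 / real (card (C (\<kappa> i)))) else 1"
  have bh: "b \<bullet> h j = b $ v j" if "b \<in> B" for b j
    using perp[OF that cell_indicator_in_range[of C "\<kappa> j"]]
    by (simp add: h_def inner_diff_right inner_axis orthogonal_def inner_commute)
  have disj: "C p \<inter> C q = {}" if "p \<noteq> q" for p q
    using indexed_partition_cell[OF C] that by (metis disjoint_iff)
  have hh: "h i \<bullet> h j = 0" if "i \<noteq> j" for i j
  proof -
    have ij: "v i \<noteq> v j" using v that by (simp add: inj_eq)
    show ?thesis
    proof (cases "inj \<kappa>")
      case True
      then have k: "\<kappa> i \<noteq> \<kappa> j" "\<kappa> j \<noteq> \<kappa> i" using that by (simp_all add: inj_eq)
      then have "v i \<notin> C (\<kappa> j)" "v j \<notin> C (\<kappa> i)" using \<kappa> disj by blast+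
      then show ?thesis
        using ij disj[OF k(1)]
        by (simp add: h_def inner_diff_left inner_diff_right inner_axis inner_axis' inner_cell_indicator,
            simp add: cell_indicator_def axis_def)
    next
      case False
      then show ?thesis using ij by (simp add: h_def t_def inner_axis_axis)
    qed
  qed
  have nh: "(norm (h j))\<^sup>2 \<le> ?c" for j
  proof (cases "inj \<kappa>")
    case True
    have "card (C (\<kappa> j)) \<noteq> 0" using \<kappa>[of j] by (auto simp: card_eq_0_iff)
    then have "(norm (h j))\<^sup>2 = 1 - 1 / real (card (C (\<kappa> j)))"
      using \<kappa>[of j] True unfolding power2_norm_eq_inner
      by (simp add: h_def t_def inner_diff_left inner_diff_right inner_axis inner_axis'
          inner_cell_indicator, simp add: cell_indicator_def axis_def)
    then show ?thesis using True by simp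
  next
    case False
    then show ?thesis by (simp add: h_def t_def)
  qed
  have "(\<Sum>b\<in>B. (\<Sum>j\<in>UNIV. b $ v j * y j)\<^sup>2) = (\<Sum>b\<in>B. (b \<bullet> (\<Sum>j\<in>UNIV. y j *\<^sub>R h j))\<^sup>2)"
    by (intro sum.cong) (simp_all add: inner_sum_right bh mult.commute)
  also have "\<dots> \<le> (norm (\<Sum>j\<in>UNIV. y j *\<^sub>R h j))\<^sup>2"
    by (rule bessel_inequality[OF fin orth])
  also have "\<dots> = (\<Sum>j\<in>UNIV. (norm (y j *\<^sub>R h j))\<^sup>2)"
    by (rule norm_sum_Pythagorean) (auto simp: pairwise_def orthogonal_def hh)
  also have "\<dots> = (\<Sum>j\<in>UNIV. (norm (h j))\<^sup>2 * (y j)\<^sup>2)"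
    by (simp add: power_mult_distrib mult.commute)
  also have "\<dots> \<le> (\<Sum>j\<in>UNIV. ?c * (y j)\<^sup>2)"
    by (intro sum_mono mult_right_mono nh) auto
  finally show ?thesis by (simp only: sum_distrib_left)
qed

section \<open>Synchronization and stable modes\<close>
lemma kron_mult_vector:
  fixes X :: "'a::comm_semiring_1^'b^'c"
  shows "((X \<otimes>\<^sub>K Y) *v (\<chi> j. u $ fst j * w $ snd j)) $ i = (X *v u) $ fst i * (Y *v w) $ snd i"
proof -
  have "((X \<otimes>\<^sub>K Y) *v (\<chi> j. u $ fst j * w $ snd j)) $ i =
      (\<Sum>(k, l)\<in>UNIV \<times> UNIV. (X $ fst i $ k * u $ k) * (Y $ snd i $ l * w $ l))"
    unfolding UNIV_Times_UNIV by (simp add: matrix_vector_mult_def case_prod_beta mult_ac)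
  also have "\<dots> = (X *v u) $ fst i * (Y *v w) $ snd i"
    unfolding sum.cartesian_product[symmetric] by (simp add: matrix_vector_mult_def sum_product)
  finally show ?thesis .
qed

text \<open>
  The product of an eigenvector \<open>u\<close> of \<open>L\<close> and an eigenvector \<open>w\<close> of \<open>A - \<mu> B\<close> gives the exponential
  solution \<open>e\<^sup>\<beta>\<^sup>t u \<otimes> w\<close>.  Since \<open>\<mu> \<noteq> 0\<close>, the vector \<open>u\<close> is not constant, so two agents
  differ by a nonzero multiple of \<open>e\<^sup>\<beta>\<^sup>t w\<close>, which must tend to zero.
\<close>
lemma synchronized_mode_stable:
  fixes a :: "real^'N^'N" and A B :: "real^'n^'n" and E :: "real^'r^'n"
  assumes g: "weighted_graph a" and sync: "synchronized a v A B E"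
    and u: "laplacian a *v u = \<mu> *\<^sub>R u" "u \<noteq> 0" "\<mu> \<noteq> 0"
    and w: "(A - \<mu> *\<^sub>R B) *v w = \<beta> *\<^sub>R w" "w \<noteq> 0"
  shows "\<beta> < 0"
proof (rule ccontr)
  assume "\<not> \<beta> < 0"
  then have \<beta>: "\<beta> \<ge> 0" by simp
  have "\<exists>i j. u $ i \<noteq> u $ j"
  proof (rule ccontr)
    assume *: "\<not> (\<exists>i j. u $ i \<noteq> u $ j)"
    have "(laplacian a *v u) $ i = 0" for i
      unfolding laplacian_mult_nth[OF g] by (intro sum.neutral) (use * in auto)
    then have "u = 0" using u(1,3) by (simp add: vec_eq_iff)
    with u(2) show False by simp
  qed
  then obtain i j where ij: "u $ i \<noteq> u $ j" by blast
  obtain p where p: "w $ p \<noteq> 0" using w(2) by (auto simp: vec_eq_iff)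
  define F where "F = network_state_matrix (laplacian a) A B"
  define x0 where "x0 = (\<chi> k. u $ fst k * w $ snd k)"
  define x where "x t = exp (\<beta> * t) *\<^sub>R x0" for t
  have "F *v x0 = \<beta> *\<^sub>R x0"
  proof -
    have "(F *v x0) $ k = (\<beta> *\<^sub>R x0) $ k" for k
    proof -
      have "(F *v x0) $ k = u $ fst k * (A *v w) $ snd k - (\<mu> * u $ fst k) * (B *v w) $ snd k"
        unfolding F_def network_state_matrix_def matrix_vector_mult_diff_rdistrib x0_def
          vector_minus_component kron_mult_vector u(1) by simp
      also have "\<dots> = u $ fst k * ((A - \<mu> *\<^sub>R B) *v w) $ snd k"
        by (simp add: matrix_vector_mult_diff_rdistrib scaleR_matrix_vector_assoc[symmetric] algebra_simps)
      also have "\<dots> = (\<beta> *\<^sub>R x0) $ k" by (simp add: w(1) x0_def)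
      finally show ?thesis .
    qed
    then show ?thesis by (simp add: vec_eq_iff)
  qed
  then have Fx: "F *v x t = (exp (\<beta> * t) * \<beta>) *\<^sub>R x0" for t
    by (simp add: x_def matrix_vector_mult_scaleR)
  have "(x has_vector_derivative (F *v x t)) (at t within {0..})" for t
    unfolding Fx unfolding x_def
    by (auto intro!: derivative_eq_intros)
  then have "state_trajectory F (leader_matrix v \<otimes>\<^sub>K E) (\<lambda>t. 0) x"
    by (simp add: state_trajectory_def)
  then have "((\<lambda>t. agent_state (x t) i - agent_state (x t) j) \<longlongrightarrow> 0) at_top"
    using sync unfolding synchronized_def F_def by blast
  then have "((\<lambda>t. (agent_state (x t) i - agent_state (x t) j) $ p) \<longlongrightarrow> 0 $ p) at_top"
    by (rule tendsto_vec_nth)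
  then have "((\<lambda>t. exp (\<beta> * t) * ((u $ i - u $ j) * w $ p)) \<longlongrightarrow> 0) at_top"
    by (simp add: agent_state_def x_def x0_def algebra_simps)
  then have "((\<lambda>t. exp (\<beta> * t) * ((u $ i - u $ j) * w $ p) / ((u $ i - u $ j) * w $ p)) \<longlongrightarrow>
      0 / ((u $ i - u $ j) * w $ p)) at_top"
    using ij p by (intro tendsto_divide tendsto_const) auto
  then have "((\<lambda>t. exp (\<beta> * t)) \<longlongrightarrow> 0) at_top"
    using ij p by simp
  moreover have "eventually (\<lambda>t. 1 \<le> exp (\<beta> * t)) at_top"
    using eventually_ge_at_top[of 0] by eventually_elim (use \<beta> in simp)
  ultimately have "(1::real) \<le> 0"
    by (intro tendsto_lowerbound) auto
  then show False by simp
qed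

lemma auxiliary_tf_zero: "auxiliary_tf A B E 0 = 0"
  by (simp add: auxiliary_tf_def transfer_function_def vec_eq_iff matrix_matrix_mult_def mat_def)

text \<open>
  The case \<open>\<mu> = 0\<close> is included because the factor \<open>\<mu>\<close> in the output makes the transfer matrix
  vanish, whatever the eigenvalues of \<open>A\<close>.
\<close>
lemma auxiliary_tf_stable:
  fixes a :: "real^'N^'N" and A B :: "real^'n^'n" and E :: "real^'r^'n"
  assumes g: "weighted_graph a" and sync: "synchronized a v A B E"
    and sym: "transpose A = A" "transpose B = B"
    and u: "laplacian a *v u = \<mu> *\<^sub>R u" "u \<noteq> 0"
    and pole: "tf_pole (auxiliary_tf A B E \<mu>) s"
  shows "Re s < 0"
proof (cases "\<mu> = 0")
  case True
  have "\<not> ratfun_pole 0 s" using ratfun_const_regular(1)[of 0 s] by simp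
  then show ?thesis using pole True by (simp add: auxiliary_tf_zero tf_pole_def)
next
  case False
  have "transpose (A - \<mu> *\<^sub>R B) = A - \<mu> *\<^sub>R B"
    using sym by (simp add: vec_eq_iff transpose_def)
  then obtain W where W: "orthonormal_eigenbasis (\<lambda>x. (A - \<mu> *\<^sub>R B) *v x)
      (\<lambda>b. b \<bullet> ((A - \<mu> *\<^sub>R B) *v b)) UNIV W"
    by (rule symmetric_orthonormal_eigenbasis[OF _ subspace_UNIV]) auto
  obtain w where w: "w \<in> W" "s = complex_of_real (w \<bullet> ((A - \<mu> *\<^sub>R B) *v w))"
    using transfer_function_poles[OF W] pole unfolding auxiliary_tf_def by blast
  have "w \<noteq> 0" "(A - \<mu> *\<^sub>R B) *v w = (w \<bullet> ((A - \<mu> *\<^sub>R B) *v w)) *\<^sub>R w"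
    using W w(1) unfolding orthonormal_eigenbasis_def by force+
  then show ?thesis
    using synchronized_mode_stable[OF g sync u False] w(2) by simp
qed

section \<open>Norms of modal expansions\<close>
lemma norm_complex_vec_power2:
  "(norm (x :: complex^'n))\<^sup>2 = (\<Sum>i\<in>UNIV. (Re (x $ i))\<^sup>2 + (Im (x $ i))\<^sup>2)"
  by (simp add: norm_vec_def L2_set_def cmod_power2 sum_nonneg)

lemma norm_paired_power2:
  fixes z :: "complex^('m::finite \<times> 'r::finite)"
  shows "(norm z)\<^sup>2 = (\<Sum>q\<in>UNIV. (\<Sum>j\<in>UNIV. (Re (z $ (j, q)))\<^sup>2) + (\<Sum>j\<in>UNIV. (Im (z $ (j, q)))\<^sup>2))"
proof -
  have "(norm z)\<^sup>2 = (\<Sum>(j, q)\<in>UNIV \<times> UNIV. (Re (z $ (j, q)))\<^sup>2 + (Im (z $ (j, q)))\<^sup>2)"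
    unfolding UNIV_Times_UNIV norm_complex_vec_power2 by (simp add: case_prod_beta)
  also have "\<dots> = (\<Sum>q\<in>UNIV. \<Sum>j\<in>UNIV. (Re (z $ (j, q)))\<^sup>2 + (Im (z $ (j, q)))\<^sup>2)"
    by (subst sum.swap) (simp add: sum.cartesian_product)
  finally show ?thesis by (simp only: sum.distrib)
qed

text \<open>
  The coordinate along \<open>b\<close>, over the nodes, of the signal \<open>(M \<otimes> I) z\<close> that the leaders inject.
\<close>
definition modal_input :: "('m::finite \<Rightarrow> 'N::finite) \<Rightarrow> real^'N \<Rightarrow> complex^('m \<times> 'r::finite) \<Rightarrow> complex^'r"
  where "modal_input v b z = (\<chi> q. \<Sum>j\<in>UNIV. of_real (b $ v j) * z $ (j, q))"

text \<open>
  The entries of the sum are constant combinations of entries of the \<open>T b\<close>, so evaluation commutes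
  with the expansion wherever no \<open>T b\<close> has a pole, even where the pencil of the network is singular.
\<close>
lemma modal_sum_eval:
  fixes T :: "real^'N \<Rightarrow> ratfun^'r^'n" and v :: "'m::finite \<Rightarrow> 'N"
  assumes reg: "\<And>b. b \<in> B \<Longrightarrow> \<not> tf_pole (T b) s"
  defines "D \<equiv> \<Sum>b\<in>B. const_matrix (mode_matrix v b) \<otimes>\<^sub>K T b"
  shows "\<not> tf_pole D s"
    and "(tf_eval D s *v z) $ (i, p) =
      (\<Sum>b\<in>B. of_real (b $ i) * (tf_eval (T b) s *v modal_input v b z) $ p)"
proof -
  have T: "\<not> ratfun_pole (T b $ p $ q) s" if "b \<in> B" for b p q
    using reg[OF that] by (auto simp: tf_pole_def)
  have D: "D $ k $ l = (\<Sum>b\<in>B. ratfun_const (b $ fst k * b $ v (fst l)) * T b $ snd k $ snd l)" for k l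
    by (simp add: D_def mode_matrix_def)
  have "\<not> ratfun_pole (D $ k $ l) s" for k l
    unfolding D by (intro ratfun_sum(1) ratfun_mult(1) ratfun_const_regular T)
  then show "\<not> tf_pole D s" by (simp add: tf_pole_def)
  have ev: "tf_eval D s $ k $ l =
      (\<Sum>b\<in>B. of_real (b $ fst k * b $ v (fst l)) * tf_eval (T b) s $ snd k $ snd l)" for k l
  proof -
    have "tf_eval D s $ k $ l =
        (\<Sum>b\<in>B. ratfun_eval (ratfun_const (b $ fst k * b $ v (fst l)) * T b $ snd k $ snd l) s)"
      unfolding tf_eval_def nth_map_matrix D
      by (intro ratfun_sum(2) ratfun_mult(1) ratfun_const_regular T)
    also have "\<dots> = (\<Sum>b\<in>B. of_real (b $ fst k * b $ v (fst l)) * tf_eval (T b) s $ snd k $ snd l)"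
    proof (rule sum.cong)
      fix b assume "b \<in> B"
      then show "ratfun_eval (ratfun_const (b $ fst k * b $ v (fst l)) * T b $ snd k $ snd l) s =
          of_real (b $ fst k * b $ v (fst l)) * tf_eval (T b) s $ snd k $ snd l"
        using T by (subst ratfun_mult(2)) (simp_all only: ratfun_const_regular tf_eval_def nth_map_matrix
            not_False_eq_True)
    qed simp
    finally show ?thesis .
  qed
  have "(tf_eval D s *v z) $ (i, p) =
      (\<Sum>l\<in>UNIV. \<Sum>b\<in>B. of_real (b $ i * b $ v (fst l)) * tf_eval (T b) s $ p $ snd l * z $ l)"
    by (simp add: matrix_vector_mult_def ev sum_distrib_right)
  also have "\<dots> = (\<Sum>b\<in>B. \<Sum>l\<in>UNIV. of_real (b $ i * b $ v (fst l)) * tf_eval (T b) s $ p $ snd l * z $ l)"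
    by (rule sum.swap)
  also have "\<dots> = (\<Sum>b\<in>B. of_real (b $ i) * (tf_eval (T b) s *v modal_input v b z) $ p)"
  proof (rule sum.cong)
    fix b
    have "(\<Sum>l\<in>UNIV. of_real (b $ i * b $ v (fst l)) * tf_eval (T b) s $ p $ snd l * z $ l) =
        (\<Sum>(j, q)\<in>UNIV \<times> UNIV. of_real (b $ i * b $ v j) * tf_eval (T b) s $ p $ q * z $ (j, q))"
      unfolding UNIV_Times_UNIV by (simp add: case_prod_beta)
    also have "\<dots> = (\<Sum>j\<in>UNIV. \<Sum>q\<in>UNIV. of_real (b $ i * b $ v j) * tf_eval (T b) s $ p $ q * z $ (j, q))"
      by (simp add: sum.cartesian_product)
    also have "\<dots> = (\<Sum>q\<in>UNIV. \<Sum>j\<in>UNIV. of_real (b $ i * b $ v j) * tf_eval (T b) s $ p $ q * z $ (j, q))"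
      by (rule sum.swap)
    also have "\<dots> = of_real (b $ i) * (tf_eval (T b) s *v modal_input v b z) $ p"
      by (simp add: matrix_vector_mult_def modal_input_def sum_distrib_left mult_ac)
    finally show "(\<Sum>l\<in>UNIV. of_real (b $ i * b $ v (fst l)) * tf_eval (T b) s $ p $ snd l * z $ l) =
        of_real (b $ i) * (tf_eval (T b) s *v modal_input v b z) $ p" .
  qed simp
  finally show "(tf_eval D s *v z) $ (i, p) =
      (\<Sum>b\<in>B. of_real (b $ i) * (tf_eval (T b) s *v modal_input v b z) $ p)" .
qed

lemma modal_output_norm:
  fixes B :: "(real^'N) set" and y :: "real^'N \<Rightarrow> complex^'n" and x :: "complex^('N \<times> 'n)"
  assumes B: "finite B" "pairwise orthogonal B" "\<forall>b\<in>B. norm b = 1"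
    and x: "\<And>i p. x $ (i, p) = (\<Sum>b\<in>B. of_real (b $ i) * y b $ p)"
  shows "(norm x)\<^sup>2 = (\<Sum>b\<in>B. (norm (y b))\<^sup>2)"
proof -
  have "(norm x)\<^sup>2 = (\<Sum>(i, p)\<in>UNIV \<times> UNIV. (Re (x $ (i, p)))\<^sup>2 + (Im (x $ (i, p)))\<^sup>2)"
    unfolding UNIV_Times_UNIV norm_complex_vec_power2 by (simp add: case_prod_beta)
  also have "\<dots> = (\<Sum>p\<in>UNIV. \<Sum>i\<in>UNIV. (Re (x $ (i, p)))\<^sup>2 + (Im (x $ (i, p)))\<^sup>2)"
    by (subst sum.swap) (simp add: sum.cartesian_product)
  also have "\<dots> = (\<Sum>p\<in>UNIV. \<Sum>b\<in>B. (Re (y b $ p))\<^sup>2 + (Im (y b $ p))\<^sup>2)"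
    by (simp add: x sum.distrib orthonormal_coefficients_norm[OF B])
  also have "\<dots> = (\<Sum>b\<in>B. (norm (y b))\<^sup>2)"
    unfolding norm_complex_vec_power2 by (rule sum.swap)
  finally show ?thesis .
qed

lemma modal_input_norm:
  fixes z :: "complex^('m::finite \<times> 'r::finite)" and B :: "(real^'N) set"
  shows "(\<Sum>b\<in>B. (norm (modal_input v b z))\<^sup>2) =
    (\<Sum>q\<in>UNIV. (\<Sum>b\<in>B. (\<Sum>j\<in>UNIV. b $ v j * Re (z $ (j, q)))\<^sup>2) +
      (\<Sum>b\<in>B. (\<Sum>j\<in>UNIV. b $ v j * Im (z $ (j, q)))\<^sup>2))"
  unfolding norm_complex_vec_power2 sum.distrib[symmetric]
  by (subst sum.swap) (simp add: modal_input_def)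

lemma modal_input_norm_le:
  fixes z :: "complex^('m::finite \<times> 'r::finite)" and B :: "(real^'N) set"
  assumes "\<And>y. (\<Sum>b\<in>B. (\<Sum>j\<in>UNIV. b $ v j * y j)\<^sup>2) \<le> c * (\<Sum>j\<in>UNIV. (y j)\<^sup>2)"
  shows "(\<Sum>b\<in>B. (norm (modal_input v b z))\<^sup>2) \<le> c * (norm z)\<^sup>2"
  unfolding modal_input_norm norm_paired_power2 sum_distrib_left distrib_left
  by (intro sum_mono add_mono) (use assms in \<open>simp_all add: sum_distrib_left\<close>)

lemma modal_input_norm_eq:
  fixes z :: "complex^('m::finite \<times> 'r::finite)" and B :: "(real^'N) set"
  assumes B: "orthonormal_eigenbasis f d UNIV B" and v: "inj v"
  shows "(\<Sum>b\<in>B. (norm (modal_input v b z))\<^sup>2) = (norm z)\<^sup>2"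
proof -
  have fin: "finite B" and orth: "pairwise orthogonal B" "\<forall>b\<in>B. norm b = 1"
    and span: "span B = UNIV"
    using B unfolding orthonormal_eigenbasis_def by blast+
  have "(\<Sum>b\<in>B. (\<Sum>j\<in>UNIV. b $ v j * y j)\<^sup>2) = (\<Sum>j\<in>UNIV. (y j)\<^sup>2)" for y :: "'m \<Rightarrow> real"
  proof -
    let ?x = "\<Sum>j\<in>UNIV. y j *\<^sub>R axis (v j) 1 :: real^'N"
    have "(\<Sum>b\<in>B. (\<Sum>j\<in>UNIV. b $ v j * y j)\<^sup>2) = (\<Sum>b\<in>B. (b \<bullet> ?x)\<^sup>2)"
      by (simp add: inner_sum_right inner_axis mult.commute)
    also have "\<dots> = (norm ?x)\<^sup>2"
      using span by (intro parseval_orthonormal[OF fin orth]) simp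
    also have "\<dots> = (\<Sum>j\<in>UNIV. (y j)\<^sup>2)"
      using v by (subst norm_sum_Pythagorean)
        (auto simp: pairwise_def orthogonal_def inner_axis_axis inj_eq)
    finally show ?thesis .
  qed
  then show ?thesis unfolding modal_input_norm norm_paired_power2 by simp
qed

lemma modal_sum_sigma_max_le:
  fixes T :: "real^'N \<Rightarrow> ratfun^'r^'n" and v :: "'m::finite \<Rightarrow> 'N"
  assumes B: "finite B" "pairwise orthogonal B" "\<forall>b\<in>B. norm b = 1"
    and reg: "\<And>b. b \<in> B \<Longrightarrow> \<not> tf_pole (T b) s"
    and t: "0 \<le> t" "\<And>b. b \<in> B \<Longrightarrow> sigma_max (tf_eval (T b) s) \<le> t"
    and c: "0 \<le> c" "\<And>y. (\<Sum>b\<in>B. (\<Sum>j\<in>UNIV. b $ v j * y j)\<^sup>2) \<le> c * (\<Sum>j\<in>UNIV. (y j)\<^sup>2)"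
  shows "sigma_max (tf_eval (\<Sum>b\<in>B. const_matrix (mode_matrix v b) \<otimes>\<^sub>K T b) s) \<le> t * sqrt c"
proof (rule sigma_max_le)
  let ?D = "\<Sum>b\<in>B. const_matrix (mode_matrix v b) \<otimes>\<^sub>K T b"
  show "0 \<le> t * sqrt c" using t c by simp
  fix z
  have T: "norm (tf_eval (T b) s *v x) \<le> t * norm x" if "b \<in> B" for b x
    using norm_le_sigma_max[of "tf_eval (T b) s" x] mult_right_mono[OF t(2)[OF that] norm_ge_zero[of x]]
    by linarith
  have "(norm (tf_eval ?D s *v z))\<^sup>2 = (\<Sum>b\<in>B. (norm (tf_eval (T b) s *v modal_input v b z))\<^sup>2)"
    by (rule modal_output_norm[OF B], rule modal_sum_eval(2), rule reg)
  also have "\<dots> \<le> (\<Sum>b\<in>B. (t * norm (modal_input v b z))\<^sup>2)"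
    by (intro sum_mono power_mono T) auto
  also have "\<dots> = t\<^sup>2 * (\<Sum>b\<in>B. (norm (modal_input v b z))\<^sup>2)"
    by (simp add: power_mult_distrib sum_distrib_left)
  also have "\<dots> \<le> t\<^sup>2 * (c * (norm z)\<^sup>2)"
    by (intro mult_left_mono modal_input_norm_le c) auto
  also have "\<dots> = (t * sqrt c * norm z)\<^sup>2"
    using c by (simp add: power_mult_distrib)
  finally show "norm (tf_eval ?D s *v z) \<le> t * sqrt c * norm z"
    by (rule power2_le_imp_le) (use t c in simp)
qed

section \<open>Bounds for the reduction error\<close>
lemma sigma_max_eval_le_hinf_norm:
  "ennreal (sigma_max (tf_eval G (\<i> * complex_of_real \<omega>))) \<le> hinf_norm G"
  unfolding hinf_norm_def by (auto intro: SUP_upper)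

lemma hinf_norm_le:
  assumes "\<And>s. tf_pole G s \<Longrightarrow> Re s < 0"
    and "\<And>\<omega>. ennreal (sigma_max (tf_eval G (\<i> * complex_of_real \<omega>))) \<le> M"
  shows "hinf_norm G \<le> M"
  using assms unfolding hinf_norm_def by (auto intro: SUP_least)

lemma ennreal_inverse_antimono: "x \<le> y \<Longrightarrow> inverse y \<le> inverse (x :: ennreal)"
proof (cases "x = 0")
  case False
  assume "x \<le> y"
  with False show ?thesis
    by (cases x; cases y) (auto simp: inverse_ennreal le_imp_inverse_le top_unique less_le)
qed simp

lemma hinf_norm_reduction_error_le:
  fixes a :: "real^'N^'N"
    and v :: "'m::finite \<Rightarrow> 'N::finite"
    and C :: "'k::finite \<Rightarrow> 'N::finite set"
    and \<kappa> :: "'m::finite \<Rightarrow> 'k::finite"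
    and A B :: "real^'n^'n"
    and E :: "real^'r^'n"
  assumes g: "weighted_graph a"
    and v: "inj v"
    and sym: "transpose A = A" "transpose B = B"
    and sync: "synchronized a v A B E"
    and C: "indexed_partition C" "almost_equitable a C"
    and \<kappa>: "\<And>i. v i \<in> C (\<kappa> i)"
  defines "c \<equiv> if inj \<kappa> then (MAX i. 1 - 1 / real (card (C (\<kappa> i)))) else 1"
  shows "0 \<le> c"
    and "hinf_norm (network_tf a v A B E - reduced_network_tf a v C A B E)
      \<le> S_max a C A B E * ennreal (sqrt c)"
proof -
  let ?L = "laplacian a" and ?P = "char_matrix C" and ?T = "auxiliary_tf A B E"
  have symL: "transpose ?L = ?L" by (rule transpose_laplacian[OF g])
  obtain d B2 where B2: "orthonormal_eigenbasis (\<lambda>x. ?L *v x) d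
      {y. \<forall>x\<in>range (\<lambda>z. ?P *v z). orthogonal x y} B2"
    and diff: "eigvals ?L - eigvals (reduced_laplacian a C) = image_mset d (mset_set B2)"
    by (rule complementary_eigenbasis[OF g C])
  have fin: "finite B2" and orth: "pairwise orthogonal B2" "\<forall>b\<in>B2. norm b = 1"
    and span: "span B2 = {y. \<forall>x\<in>range (\<lambda>z. ?P *v z). orthogonal x y}"
    and ev: "\<And>b. b \<in> B2 \<Longrightarrow> ?L *v b = d b *\<^sub>R b"
    using B2 unfolding orthonormal_eigenbasis_def by blast+
  have red: "reduced_network_tf a v C A B E =
      transfer_function (network_state_matrix ?L A B)
        ((?P ** reduced_leader_matrix v C) \<otimes>\<^sub>K E) (?L \<otimes>\<^sub>K mat 1)"
    unfolding reduced_network_tf_def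
    by (rule reduced_transfer[OF symL sym almost_equitable_intertwines[OF g C]
        cell_average_char_matrix(1)[OF C(1)]])
  define D where "D = network_tf a v A B E - reduced_network_tf a v C A B E"
  have D: "D = (\<Sum>b\<in>B2. const_matrix (mode_matrix v b) \<otimes>\<^sub>K ?T (d b))"
    unfolding D_def red network_tf_def transfer_function_diff[symmetric] kron_distribs(3)[symmetric]
      leader_residual_modes[OF C(1) B2]
    by (rule network_mode_sum[OF symL sym B2])
  have stable: "Re s < 0" if "b \<in> B2" "tf_pole (?T (d b)) s" for b s
  proof -
    have "b \<noteq> 0" using orth that(1) by auto
    then show ?thesis
      using auxiliary_tf_stable[OF g sync sym ev[OF that(1)] _ that(2)] by blast
  qed
  show c0: "0 \<le> c"
  proof (cases "inj \<kappa>")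
    case True
    have "1 \<le> card (C (\<kappa> undefined))"
      using \<kappa>[of undefined] by (auto simp: Suc_le_eq card_gt_0_iff)
    then have "0 \<le> 1 - 1 / real (card (C (\<kappa> undefined)))" by (simp add: field_simps)
    also have "\<dots> \<le> (MAX i. 1 - 1 / real (card (C (\<kappa> i))))" by (intro Max_ge) auto
    finally show ?thesis using True by (simp add: c_def)
  qed (simp add: c_def)
  have energy: "(\<Sum>b\<in>B2. (\<Sum>j\<in>UNIV. b $ v j * y j)\<^sup>2) \<le> c * (\<Sum>j\<in>UNIV. (y j)\<^sup>2)" for y
    unfolding c_def
  proof (rule leader_energy_bound[OF fin orth _ C(1) v \<kappa>])
    fix b x assume "b \<in> B2" "x \<in> range (\<lambda>z. ?P *v z)"
    then show "orthogonal x b" using span span_base[of b B2] by blast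
  qed
  have "hinf_norm D \<le> S_max a C A B E * ennreal (sqrt c)"
  proof (rule hinf_norm_le)
    fix s assume pole: "tf_pole D s"
    show "Re s < 0"
    proof (rule ccontr)
      assume "\<not> Re s < 0"
      then have "\<not> tf_pole (?T (d b)) s" if "b \<in> B2" for b using stable that by blast
      then have "\<not> tf_pole D s" unfolding D by (rule modal_sum_eval(1))
      with pole show False by simp
    qed
  next
    fix \<omega> :: real
    let ?s = "\<i> * complex_of_real \<omega>"
    have reg: "\<not> tf_pole (?T (d b)) ?s" if "b \<in> B2" for b
      using stable[OF that, of ?s] by auto
    \<comment> \<open>The eigenbasis is empty if all cells are singletons; inserting \<open>0\<close> then makes the error vanish.\<close>
    let ?X = "insert 0 ((\<lambda>b. sigma_max (tf_eval (?T (d b)) ?s)) ` B2)"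
    define t where "t = Max ?X"
    have finX: "finite ?X" using fin by simp
    have t: "0 \<le> t" "\<And>b. b \<in> B2 \<Longrightarrow> sigma_max (tf_eval (?T (d b)) ?s) \<le> t"
      unfolding t_def using finX by (auto intro: Max_ge)
    have "t \<in> ?X" unfolding t_def using finX by (intro Max_in) auto
    then have tS: "ennreal t \<le> S_max a C A B E"
    proof safe
      fix b assume b: "b \<in> B2"
      have "ennreal (sigma_max (tf_eval (?T (d b)) ?s)) \<le> hinf_norm (?T (d b))"
        by (rule sigma_max_eval_le_hinf_norm)
      also have "\<dots> \<le> S_max a C A B E"
        unfolding S_max_def diff using b fin by (intro SUP_upper) auto
      finally show "ennreal (sigma_max (tf_eval (?T (d b)) ?s)) \<le> S_max a C A B E" .
    qed simp
    have "sigma_max (tf_eval D ?s) \<le> t * sqrt c"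
      unfolding D by (rule modal_sum_sigma_max_le[OF fin orth reg t c0 energy])
    then have "ennreal (sigma_max (tf_eval D ?s)) \<le> ennreal t * ennreal (sqrt c)"
      using t(1) c0 by (metis ennreal_leI ennreal_mult real_sqrt_ge_zero)
    also have "\<dots> \<le> S_max a C A B E * ennreal (sqrt c)"
      by (intro mult_right_mono tS) auto
    finally show "ennreal (sigma_max (tf_eval D ?s)) \<le> S_max a C A B E * ennreal (sqrt c)" .
  qed
  then show "hinf_norm (network_tf a v A B E - reduced_network_tf a v C A B E)
      \<le> S_max a C A B E * ennreal (sqrt c)"
    by (simp only: D_def)
qed

text \<open>
  The witness is the input \<open>+1\<close> at one leader and \<open>-1\<close> at another one, equal in all components.  It
  is orthogonal to constants, so its modal coordinates along the kernel of \<open>L\<close> vanish, and those along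
  the remaining modes are amplified at least by the smallest \<open>\<sigma>\<^sub>m\<^sub>i\<^sub>n\<close>.
\<close>
lemma S_min_le_hinf_norm:
  fixes a :: "real^'N^'N" and v :: "'m::finite \<Rightarrow> 'N"
    and A B :: "real^'n^'n" and E :: "real^'r^'n"
  assumes g: "weighted_graph a" "connected_graph a" and v: "inj v"
    and sym: "transpose A = A" "transpose B = B"
    and sync: "synchronized a v A B E"
    and two: "2 \<le> CARD('m)"
  shows "S_min a A B E \<le> hinf_norm (network_tf a v A B E)"
proof -
  let ?L = "laplacian a" and ?T = "auxiliary_tf A B E"
  have symL: "transpose ?L = ?L" by (rule transpose_laplacian[OF g(1)])
  obtain S where S: "orthonormal_eigenbasis (\<lambda>x. ?L *v x) (\<lambda>b. b \<bullet> (?L *v b)) UNIV S"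
    by (rule symmetric_orthonormal_eigenbasis[OF symL subspace_UNIV]) auto
  define d where "d b = b \<bullet> (?L *v b)" for b
  have Sd: "orthonormal_eigenbasis (\<lambda>x. ?L *v x) d UNIV S"
    using S by (simp only: d_def[abs_def])
  have fin: "finite S" and orth: "pairwise orthogonal S" "\<forall>b\<in>S. norm b = 1"
    and ev: "\<And>b. b \<in> S \<Longrightarrow> ?L *v b = d b *\<^sub>R b"
    using Sd unfolding orthonormal_eigenbasis_def by blast+
  have net: "network_tf a v A B E = (\<Sum>b\<in>S. const_matrix (mode_matrix v b) \<otimes>\<^sub>K ?T (d b))"
    unfolding network_tf_def leader_matrix_modes[OF Sd]
    by (rule network_mode_sum[OF symL sym Sd])
  have reg: "\<not> tf_pole (?T (d b)) 0" if "b \<in> S" for b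
  proof
    assume "tf_pole (?T (d b)) 0"
    moreover have "b \<noteq> 0" using orth that by auto
    ultimately have "Re 0 < 0"
      by (intro auxiliary_tf_stable[OF g(1) sync sym ev[OF that]])
    then show False by simp
  qed
  obtain i1 i2 :: 'm where i12: "i1 \<noteq> i2"
    using two card_le_Suc0_iff_eq[of "UNIV :: 'm set"] by fastforce
  define z :: "complex^('m \<times> 'r)" where
    "z = (\<chi> jq. (if fst jq = i1 then 1 else 0) - (if fst jq = i2 then 1 else 0))"
  have "z \<noteq> 0"
    using i12 by (auto simp: vec_eq_iff z_def intro!: exI[of _ i1])
  then have z: "norm z > 0" by simp
  have zero: "modal_input v b z = 0" if "b \<in> S" "d b = 0" for b
  proof -
    have "?L *v b = 0" using ev[OF that(1)] that(2) by simp
    then obtain \<beta> where const: "\<And>j. b $ v j = \<beta>"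
      using laplacian_kernel[OF g] by blast
    show ?thesis
      unfolding modal_input_def const sum_distrib_left[symmetric]
      by (simp add: vec_eq_iff z_def sum_subtractf)
  qed
  define J where "J = {b \<in> S. d b \<noteq> 0}"
  \<comment> \<open>The input \<open>z\<close> is not zero and all its energy sits in the modes outside the kernel.\<close>
  have "J \<noteq> {}"
  proof
    assume "J = {}"
    then have "(\<Sum>b\<in>S. (norm (modal_input v b z))\<^sup>2) = 0"
      using zero by (intro sum.neutral) (auto simp: J_def)
    then show False using modal_input_norm_eq[OF Sd v, of z] z by simp
  qed
  define \<sigma> where "\<sigma> b = sigma_min (tf_eval (?T (d b)) 0)" for b
  define m where "m = Min (\<sigma> ` J)"
  have finJ: "finite J" using fin by (simp add: J_def)
  then have "m \<in> \<sigma> ` J" unfolding m_def using \<open>J \<noteq> {}\<close> by (intro Min_in) auto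
  then obtain b0 where b0: "b0 \<in> J" "m = \<sigma> b0" by blast
  have m0: "0 \<le> m" unfolding b0 \<sigma>_def by (rule sigma_min_nonneg)
  have "d b0 \<in> set_mset (eigvals ?L) - {0}"
    using b0(1) fin by (auto simp: eigvals_orthonormal_eigenbasis[OF Sd] J_def)
  then have "S_min a A B E \<le> ennreal m"
    unfolding S_min_def b0(2) \<sigma>_def by (rule INF_lower)
  also have "m \<le> sigma_max (tf_eval (network_tf a v A B E) 0)"
  proof -
    let ?D = "network_tf a v A B E"
    have le: "(m * norm (modal_input v b z))\<^sup>2 \<le> (norm (tf_eval (?T (d b)) 0 *v modal_input v b z))\<^sup>2"
      if "b \<in> S" for b
    proof (cases "d b = 0")
      case False
      then have "m \<le> \<sigma> b" unfolding m_def using that finJ by (intro Min_le) (auto simp: J_def)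
      then have "m * norm (modal_input v b z) \<le> \<sigma> b * norm (modal_input v b z)"
        by (intro mult_right_mono) auto
      also have "\<dots> \<le> norm (tf_eval (?T (d b)) 0 *v modal_input v b z)"
        unfolding \<sigma>_def by (rule sigma_min_norm_le)
      finally show ?thesis using m0 by (intro power_mono) auto
    qed (simp add: zero[OF that])
    have "(m * norm z)\<^sup>2 = (\<Sum>b\<in>S. (m * norm (modal_input v b z))\<^sup>2)"
      unfolding power_mult_distrib sum_distrib_left[symmetric] modal_input_norm_eq[OF Sd v] ..
    also have "\<dots> \<le> (\<Sum>b\<in>S. (norm (tf_eval (?T (d b)) 0 *v modal_input v b z))\<^sup>2)"
      by (intro sum_mono le)
    also have "\<dots> = (norm (tf_eval ?D 0 *v z))\<^sup>2"
      unfolding net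
      by (rule modal_output_norm[OF fin orth, symmetric], rule modal_sum_eval(2), rule reg)
    finally have "m * norm z \<le> norm (tf_eval ?D 0 *v z)"
      by (rule power2_le_imp_le) simp
    also have "\<dots> \<le> sigma_max (tf_eval ?D 0) * norm z"
      by (rule norm_le_sigma_max)
    finally show ?thesis using z by simp
  qed
  then have "ennreal m \<le> ennreal (sigma_max (tf_eval (network_tf a v A B E) 0))"
    by (rule ennreal_leI)
  also have "\<dots> \<le> hinf_norm (network_tf a v A B E)"
    using sigma_max_eval_le_hinf_norm[of "network_tf a v A B E" 0] by simp
  finally show ?thesis .
qed

theorem theorem15:
  fixes a :: "real^'N^'N"
    and v :: "'m::finite \<Rightarrow> 'N::finite"
    and C :: "'k::finite \<Rightarrow> 'N::finite set"
    and \<kappa> :: "'m::finite \<Rightarrow> 'k::finite"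
    and A B :: "real^'n^'n"
    and E :: "real^'r^'n"
  assumes graph: "weighted_graph a" "connected_graph a"
    and leaders: "inj v"
    and sym: "transpose A = A" "transpose B = B"
    and sync: "synchronized a v A B E"
    and part: "indexed_partition C" "almost_equitable a C"
    and leader_cells: "\<And>i. v i \<in> C (\<kappa> i)"
  shows "(hinf_norm (network_tf a v A B E - reduced_network_tf a v C A B E))\<^sup>2
         \<le> (S_max a C A B E)\<^sup>2 *
            ennreal (if inj \<kappa> then (MAX i. 1 - 1 / real (card (C (\<kappa> i)))) else 1)
    \<and> (2 \<le> CARD('m) \<and> hinf_norm (network_tf a v A B E) \<noteq> 0 \<and> S_min a A B E \<noteq> 0 \<longrightarrow>
         (hinf_norm (network_tf a v A B E - reduced_network_tf a v C A B E))\<^sup>2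
           / (hinf_norm (network_tf a v A B E))\<^sup>2
         \<le> (S_max a C A B E)\<^sup>2 / (S_min a A B E)\<^sup>2 *
            ennreal (if inj \<kappa> then (MAX i. 1 - 1 / real (card (C (\<kappa> i)))) else 1))"
proof -
  let ?c = "if inj \<kappa> then (MAX i. 1 - 1 / real (card (C (\<kappa> i)))) else 1"
  let ?X = "hinf_norm (network_tf a v A B E - reduced_network_tf a v C A B E)"
  let ?N = "hinf_norm (network_tf a v A B E)"
  note bound = hinf_norm_reduction_error_le[OF graph(1) leaders sym sync part leader_cells]
  have "?X\<^sup>2 \<le> (S_max a C A B E * ennreal (sqrt ?c))\<^sup>2"
    using bound(2) by (rule power_mono) simp
  also have "\<dots> = (S_max a C A B E)\<^sup>2 * ennreal ?c"
    using bound(1) by (simp only: power_mult_distrib ennreal_power real_sqrt_ge_zero real_sqrt_pow2)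
  finally have 1: "?X\<^sup>2 \<le> (S_max a C A B E)\<^sup>2 * ennreal ?c" .
  have 2: "?X\<^sup>2 / ?N\<^sup>2 \<le> (S_max a C A B E)\<^sup>2 / (S_min a A B E)\<^sup>2 * ennreal ?c" if "2 \<le> CARD('m)"
  proof -
    have "S_min a A B E \<le> ?N"
      by (rule S_min_le_hinf_norm[OF graph leaders sym sync that])
    then have "inverse (?N\<^sup>2) \<le> inverse ((S_min a A B E)\<^sup>2)"
      by (intro ennreal_inverse_antimono power_mono) auto
    with 1 have "?X\<^sup>2 * inverse (?N\<^sup>2) \<le>
        ((S_max a C A B E)\<^sup>2 * ennreal ?c) * inverse ((S_min a A B E)\<^sup>2)"
      by (intro mult_mono) auto
    then show ?thesis by (simp only: divide_ennreal_def ac_simps)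
  qed
  from 1 2 show ?thesis by blast
qed

end
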